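(* Let $E$ and $X$ be complex Banach spaces. Suppose that $k\in\mathbb{R}$, $1\le q<\infty$, $1/q'+1/q=1$ and $(R(t))_{t>0}\subseteq L(E,X)$ is a strongly continuous operator family satisfying $$M:=\sum_{j=0}^{\infty}\|R(\cdot)\|_{L^{q'}[j,j+1]}<\infty.$$ If $g:\mathbb{R}\to E$ is Stepanov $q$-semi-Bloch $k$-periodic (respectively, Stepanov $q$-semi-anti-periodic), then the function $G:\mathbb{R}\to X$ given by $$G(t):=\int_{-\infty}^{t}R(t-s)g(s)\,ds,\quad t\in\mathbb{R},$$ is well-defined and semi-Bloch $k$-periodic (respectively, semi-anti-periodic).
   Context: $L(E,X)$ is the space of bounded linear operators from $E$ to $X$. Here $\|R(\cdot)\|_{L^{q'}[j,j+1]}$ denotes the $L^{q'}$-norm over $[j,j+1]$ of the scalar function $t\mapsto\|R(t)\|_{L(E,X)}$ (with $q'=\infty$ if $q=1$). For a complex Banach space $Y$, $C_b(\mathbb{R}:Y)$ is the space of bounded continuous functions $\mathbb{R}\to Y$. A function $f\in C_b(\mathbb{R}:Y)$ is semi-Bloch $k$-periodic if for every $\varepsilon>0$ there exists $p>0$ such that for all $m\in\mathbb{Z}$ and all $x\in\mathbb{R}$ one has $\|f(x+mp)-e^{ikmp}f(x)\|\le\varepsilon$. It is semi-anti-periodic if for every $\varepsilon>0$ there exists $p>0$ such that for all $m\in\mathbb{Z}$ and all $x\in\mathbb{R}$ one has $\|f(x+mp)-(-1)^m f(x)\|\le\varepsilon$. A function $f\in L^q_{loc}(\mathbb{R}:E)$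 is Stepanov $q$-bounded, written $f\in L^q_S(\mathbb{R}:E)$, if $\sup_{t\in\mathbb{R}}\bigl(\int_t^{t+1}\|f(s)\|^q\,ds\bigr)^{1/q}<\infty$. A function $f\in L^q_S(\mathbb{R}:E)$ is Stepanov $q$-semi-Bloch $k$-periodic (respectively, Stepanov $q$-semi-anti-periodic) if the function $\hat f:\mathbb{R}\to L^q([0,1]:E)$ defined by $\hat f(t)(s):=f(t+s)$, $t\in\mathbb{R}$, $s\in[0,1]$, is semi-Bloch $k$-periodic (respectively, semi-anti-periodic). *)

theory Defs
  imports
    "HOL-Analysis.Analysis"
    "HOL-Probability.Essential_Supremum"
    "HOL-Library.Function_Algebras"
begin

section \<open>Complex Banach spaces\<close>

class complex_vector = real_vector +
  fixes scaleC :: "complex \<Rightarrow> 'a \<Rightarrow> 'a"  (infixr "*\<^sub>C" 75)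
  assumes scaleC_add_right: "a *\<^sub>C (x + y) = a *\<^sub>C x + a *\<^sub>C y"
    and scaleC_add_left: "(a + b) *\<^sub>C x = a *\<^sub>C x + b *\<^sub>C x"
    and scaleC_scaleC: "a *\<^sub>C b *\<^sub>C x = (a * b) *\<^sub>C x"
    and scaleC_one: "1 *\<^sub>C x = x"
    and scaleC_of_real: "complex_of_real r *\<^sub>C x = r *\<^sub>R x"

class complex_banach = complex_vector + banach +
  assumes norm_scaleC: "norm (a *\<^sub>C x) = cmod a * norm x"

instantiation complex :: complex_banach
begin
definition scaleC_complex :: "complex \<Rightarrow> complex \<Rightarrow> complex"
  where "scaleC_complex a x = a * x"
instance
  by standard (auto simp: scaleC_complex_def algebra_simps scaleR_conv_of_real norm_mult)
end

text \<open>Functions form a complex vector space pointwise; this is the ambient space of \<open>Lp_space\<close>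
  below.\<close>

instantiation "fun" :: (type, real_vector) real_vector
begin
definition scaleR_fun :: "real \<Rightarrow> ('a \<Rightarrow> 'b) \<Rightarrow> 'a \<Rightarrow> 'b"
  where "scaleR_fun r f = (\<lambda>x. r *\<^sub>R f x)"
instance
  by standard (auto simp: scaleR_fun_def fun_eq_iff algebra_simps)
end

instantiation "fun" :: (type, complex_vector) complex_vector
begin
definition scaleC_fun :: "complex \<Rightarrow> ('a \<Rightarrow> 'b) \<Rightarrow> 'a \<Rightarrow> 'b"
  where "scaleC_fun a f = (\<lambda>x. a *\<^sub>C f x)"
instance
  by standard
    (auto simp: scaleC_fun_def scaleR_fun_def fun_eq_iff
      scaleC_add_right scaleC_add_left scaleC_scaleC scaleC_one scaleC_of_real)
end

text \<open>The type \<open>'e \<Rightarrow>\<^sub>L 'x\<close> consists of the bounded real-linear operators; \<open>L(E,X)\<close> is cut out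
  of it by complex homogeneity, and its operator norm is the one of the type.\<close>

definition clinear_ops :: "('e::complex_banach \<Rightarrow>\<^sub>L 'x::complex_banach) set"
  where "clinear_ops = {T. \<forall>a x. blinfun_apply T (a *\<^sub>C x) = a *\<^sub>C blinfun_apply T x}"

definition strongly_continuous_family :: "(real \<Rightarrow> 'e::complex_banach \<Rightarrow>\<^sub>L 'x::complex_banach) \<Rightarrow> bool"
  where "strongly_continuous_family R \<longleftrightarrow>
    (\<forall>t>0. R t \<in> clinear_ops) \<and> (\<forall>x. continuous_on {0<..} (\<lambda>t. blinfun_apply (R t) x))"


section \<open>Strong measurability and the Bochner integral\<close>

text \<open>The library's \<open>has_bochner_integral\<close> is restricted to second countable value spaces. Here the
  value space is an arbitrary normed space, so Borel measurability is replaced by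
  strong measurability (an a.e. limit of simple functions).\<close>

definition strongly_measurable :: "'a measure \<Rightarrow> ('a \<Rightarrow> 'b::real_normed_vector) \<Rightarrow> bool"
  where "strongly_measurable M f \<longleftrightarrow>
    (\<exists>s. (\<forall>i::nat. simple_function M (s i)) \<and> (AE x in M. (\<lambda>i. s i x) \<longlonglongrightarrow> f x))"

definition has_Bochner_integral :: "'a measure \<Rightarrow> ('a \<Rightarrow> 'b::real_normed_vector) \<Rightarrow> 'b \<Rightarrow> bool"
  where "has_Bochner_integral M f y \<longleftrightarrow>
    strongly_measurable M f \<and>
    (\<exists>s. (\<forall>i::nat. Bochner_Integration.simple_bochner_integrable M (s i)) \<and>
         (\<lambda>i. \<integral>\<^sup>+x. ennreal (norm (f x - s i x)) \<partial>M) \<longlonglongrightarrow> 0 \<and>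
         (\<lambda>i. Bochner_Integration.simple_bochner_integral M (s i)) \<longlonglongrightarrow> y)"

definition Bochner_integrable :: "'a measure \<Rightarrow> ('a \<Rightarrow> 'b::real_normed_vector) \<Rightarrow> bool"
  where "Bochner_integrable M f \<longleftrightarrow> (\<exists>y. has_Bochner_integral M f y)"

definition Bochner_integral :: "'a measure \<Rightarrow> ('a \<Rightarrow> 'b::real_normed_vector) \<Rightarrow> 'b"
  where "Bochner_integral M f = (THE y. has_Bochner_integral M f y)"

lemma has_Bochner_integral_library:
  fixes f :: "'a \<Rightarrow> 'b::{real_normed_vector, second_countable_topology}"
  assumes "has_bochner_integral M f y"
  shows "has_Bochner_integral M f y"
  using assms
proof cases
  case (1 s)
  obtain F where "\<And>i. simple_function M (F i)" "\<And>x. x \<in> space M \<Longrightarrow> (\<lambda>i. F i x) \<longlonglongrightarrow> f x"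
    using borel_measurable_implies_sequence_metric[OF \<open>f \<in> borel_measurable M\<close>, of 0] by blast
  then have "strongly_measurable M f"
    unfolding strongly_measurable_def by blast
  with 1 show ?thesis unfolding has_Bochner_integral_def by blast
qed


section \<open>Lebesgue spaces\<close>

text \<open>The exponent ranges over \<open>[1, \<infinity>]\<close>; the value is \<open>\<infinity>\<close> outside \<open>L\<^sup>p\<close>.\<close>

definition Lp_norm :: "ennreal \<Rightarrow> 'a measure \<Rightarrow> ('a \<Rightarrow> 'b::real_normed_vector) \<Rightarrow> ennreal"
  where "Lp_norm p M f =
    (if p = \<infinity> then esssup M (\<lambda>x. ennreal (norm (f x)))
     else let I = \<integral>\<^sup>+x. ennreal (norm (f x) powr enn2real p) \<partial>M
          in if I = \<infinity> then \<infinity> else ennreal (enn2real I powr (1 / enn2real p)))"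

text \<open>The elements are functions rather than a.e. classes, so \<open>Lp_norm\<close> is a seminorm here.\<close>

definition Lp_space :: "ennreal \<Rightarrow> 'a measure \<Rightarrow> ('a \<Rightarrow> 'b::real_normed_vector) set"
  where "Lp_space p M = {f. strongly_measurable M f \<and> Lp_norm p M f < \<infinity>}"


section \<open>Semi-Bloch periodic and semi-anti-periodic functions\<close>

text \<open>The space of values is a linear subspace \<open>V\<close> with a (semi)norm \<open>N\<close>, so that the same
  definitions apply to a Banach space type (\<open>V = UNIV\<close>, \<open>N = norm\<close>) and to \<open>L\<^sup>q([0,1] : E)\<close>.\<close>

definition bounded_continuous_in :: "'y::complex_vector set \<Rightarrow> ('y \<Rightarrow> real) \<Rightarrow> (real \<Rightarrow> 'y) \<Rightarrow> bool"
  where "bounded_continuous_in V N f \<longleftrightarrow>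
    range f \<subseteq> V \<and>
    (\<exists>B. \<forall>t. N (f t) \<le> B) \<and>
    (\<forall>t. \<forall>\<epsilon>>0. \<exists>\<delta>>0. \<forall>u. \<bar>u - t\<bar> < \<delta> \<longrightarrow> N (f u - f t) < \<epsilon>)"

lemma bounded_continuous_in_norm:
  fixes f :: "real \<Rightarrow> 'y::complex_banach"
  shows "bounded_continuous_in UNIV norm f \<longleftrightarrow> continuous_on UNIV f \<and> bounded (range f)"
  unfolding bounded_continuous_in_def continuous_on_iff bounded_iff
  by (auto simp: dist_norm)

definition semi_Bloch_periodic_in ::
    "'y::complex_vector set \<Rightarrow> ('y \<Rightarrow> real) \<Rightarrow> real \<Rightarrow> (real \<Rightarrow> 'y) \<Rightarrow> bool"
  where "semi_Bloch_periodic_in V N k f \<longleftrightarrow>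
    bounded_continuous_in V N f \<and>
    (\<forall>\<epsilon>>0. \<exists>p>0. \<forall>m::int. \<forall>x.
      N (f (x + of_int m * p) - exp (\<i> * of_real (k * of_int m * p)) *\<^sub>C f x) \<le> \<epsilon>)"

definition semi_anti_periodic_in ::
    "'y::complex_vector set \<Rightarrow> ('y \<Rightarrow> real) \<Rightarrow> (real \<Rightarrow> 'y) \<Rightarrow> bool"
  where "semi_anti_periodic_in V N f \<longleftrightarrow>
    bounded_continuous_in V N f \<and>
    (\<forall>\<epsilon>>0. \<exists>p>0. \<forall>m::int. \<forall>x.
      N (f (x + of_int m * p) - ((-1) powi m) *\<^sub>C f x) \<le> \<epsilon>)"

definition semi_Bloch_periodic :: "real \<Rightarrow> (real \<Rightarrow> 'y::complex_banach) \<Rightarrow> bool"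
  where "semi_Bloch_periodic k f \<longleftrightarrow> semi_Bloch_periodic_in UNIV norm k f"

definition semi_anti_periodic :: "(real \<Rightarrow> 'y::complex_banach) \<Rightarrow> bool"
  where "semi_anti_periodic f \<longleftrightarrow> semi_anti_periodic_in UNIV norm f"


section \<open>The Stepanov classes\<close>

definition Lp_loc :: "real \<Rightarrow> (real \<Rightarrow> 'e::complex_banach) set"
  where "Lp_loc q = {f. \<forall>a b. f \<in> Lp_space (ennreal q) (lebesgue_on {a..b})}"

definition Stepanov_bounded :: "real \<Rightarrow> (real \<Rightarrow> 'e::complex_banach) \<Rightarrow> bool"
  where "Stepanov_bounded q f \<longleftrightarrow>
    f \<in> Lp_loc q \<and> (SUP t. Lp_norm (ennreal q) (lebesgue_on {t..t+1}) f) < \<infinity>"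

text \<open>Only the values for \<open>s \<in> [0,1]\<close> matter, as \<open>hat f t\<close> is regarded as an element of
  \<open>unit_Lp q\<close>.\<close>

definition hat :: "(real \<Rightarrow> 'e) \<Rightarrow> real \<Rightarrow> real \<Rightarrow> 'e"
  where "hat f t s = f (t + s)"

abbreviation unit_Lp :: "real \<Rightarrow> (real \<Rightarrow> 'e::complex_banach) set"
  where "unit_Lp q \<equiv> Lp_space (ennreal q) (lebesgue_on {0..1})"

text \<open>On the linear space \<open>unit_Lp q\<close> the norm is finite, so \<open>enn2real\<close> loses nothing.\<close>

abbreviation unit_Lp_norm :: "real \<Rightarrow> (real \<Rightarrow> 'e::complex_banach) \<Rightarrow> real"
  where "unit_Lp_norm q h \<equiv> enn2real (Lp_norm (ennreal q) (lebesgue_on {0..1}) h)"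

definition Stepanov_semi_Bloch_periodic :: "real \<Rightarrow> real \<Rightarrow> (real \<Rightarrow> 'e::complex_banach) \<Rightarrow> bool"
  where "Stepanov_semi_Bloch_periodic q k f \<longleftrightarrow>
    Stepanov_bounded q f \<and> semi_Bloch_periodic_in (unit_Lp q) (unit_Lp_norm q) k (hat f)"

definition Stepanov_semi_anti_periodic :: "real \<Rightarrow> (real \<Rightarrow> 'e::complex_banach) \<Rightarrow> bool"
  where "Stepanov_semi_anti_periodic q f \<longleftrightarrow>
    Stepanov_bounded q f \<and> semi_anti_periodic_in (unit_Lp q) (unit_Lp_norm q) (hat f)"

end

theory Submission
  imports Defs
begin

text \<open>
  Substituting \<open>r = t - s\<close> turns \<open>G t\<close> into the integral of \<open>R r (g (t - r))\<close> over \<open>r > 0\<close>. Cutting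
  the half-line into the intervals \<open>[j, j + 1]\<close> and applying Hoelder's inequality on each of them
  gives, for every strongly measurable \<open>h\<close>, the bound
  \<open>\<integral> \<parallel>R r (h (t - r))\<parallel> dr \<le> (\<Sum>j. \<parallel>R\<parallel>\<^sub>j * \<parallel>hat h (t - j - 1)\<parallel>)\<close>, where \<open>\<parallel>R\<parallel>\<^sub>j\<close> is the
  Lebesgue norm of \<open>R\<close> with exponent \<open>q'\<close> on \<open>[j, j + 1]\<close> and \<open>hat h\<close> is measured in \<open>L\<^sup>q [0,1]\<close>
  (\<open>nn_integral_convolution_le\<close>). Everything follows from this one estimate:

  \<^item> With \<open>h = g\<close> the right-hand side is finite, because \<open>hat g\<close> is bounded and the norms of \<open>R\<close> are
    summable. So the integral defining \<open>G\<close> exists (\<open>integrable_G\<close>).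

  \<^item> The map from \<open>g\<close> to \<open>G\<close> commutes with translations, and with multiplication by a complex
    number \<open>c\<close> because each \<open>R r\<close> is complex linear. So \<open>h s = g (s + p) - c g s\<close> turns the estimate into a bound for
    \<open>G (x + p) - c G x\<close> in terms of the corresponding differences of \<open>hat g\<close> (\<open>norm_G_diff_le\<close>). If
    the latter are at most \<open>\<epsilon>\<close>, the former are at most \<open>(\<Sum>j. \<parallel>R\<parallel>\<^sub>j) * \<epsilon>\<close>. Both \<open>exp (\<i> k m p)\<close> and \<open>(-1)\<^sup>m\<close>
    are admissible as \<open>c\<close>, which settles the two kinds of periodicity (\<open>semi_periodic_transfer\<close>).

  \<^item> For \<open>c = 1\<close> and \<open>p \<longlongrightarrow> 0\<close> every single term of the series tends to 0 by the continuity of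
    \<open>hat g\<close>, and the series is dominated by a multiple of the summable norms of \<open>R\<close>. Tannery's
    theorem then yields the continuity of \<open>G\<close> (\<open>bounded_continuous_G\<close>).

  The Banach spaces need not be separable, so Borel measurability is of little use for
  vector-valued functions. The first half of the development therefore treats strong measurability
  and the Bochner integral over complete measures: it is enough to know that strong measurability
  amounts to measurable distances to points together with an essentially separable range, that a
  strongly measurable function with integrable norm has an integral, and how the integral behaves
  under bounded linear maps and measure-preserving substitutions.
\<close>

section \<open>Strong measurability over complete measures\<close>

lemma (in complete_measure) borel_measurable_AE_eq:
  assumes "f \<in> borel_measurable M" and "AE x in M. f x = g x"
  shows "g \<in> borel_measurable M"
proof (rule borel_measurableI)
  fix S :: "'b set" assume "open S"
  with assms(1) have "f -` S \<inter> space M \<in> sets M" by (simp add: borel_open measurable_sets)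
  then show "g -` S \<inter> space M \<in> sets M"
    by (rule in_sets_AE[rotated]) (use assms(2) in auto)
qed

lemma (in complete_measure) borel_measurable_AE_LIMSEQ:
  fixes F :: "nat \<Rightarrow> 'a \<Rightarrow> real"
  assumes meas: "\<And>i. F i \<in> borel_measurable M" and lim: "AE x in M. (\<lambda>i. F i x) \<longlonglongrightarrow> f x"
  shows "f \<in> borel_measurable M"
proof (rule borel_measurable_AE_eq)
  show "(\<lambda>x. lim (\<lambda>i. F i x)) \<in> borel_measurable M"
    using meas by measurable
  show "AE x in M. lim (\<lambda>i. F i x) = f x"
    using lim by eventually_elim (rule limI)
qed

lemma complete_measure_lebesgue_on:
  assumes "S \<in> sets lebesgue"
  shows "complete_measure (lebesgue_on S)"
proof
  fix A B assume "B \<subseteq> A" "A \<in> null_sets (lebesgue_on S)"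
  then show "B \<in> sets (lebesgue_on S)"
    using assms
    by (auto simp: null_sets_restrict_space sets_restrict_space_iff intro: completion.complete)
qed

text \<open>The distance of two simple functions is again simple, and distances pass to a.e. limits.
  Completeness of the measure absorbs the exceptional null set.\<close>

lemma (in complete_measure) dist_strongly_measurable:
  assumes "strongly_measurable M f" and "strongly_measurable M g"
  shows "(\<lambda>x. dist (f x) (g x)) \<in> borel_measurable M"
proof -
  from assms obtain s r where
    s: "\<And>i::nat. simple_function M (s i)" "AE x in M. (\<lambda>i. s i x) \<longlonglongrightarrow> f x" and
    r: "\<And>i::nat. simple_function M (r i)" "AE x in M. (\<lambda>i. r i x) \<longlonglongrightarrow> g x"
    unfolding strongly_measurable_def by blast
  show ?thesis
  proof (rule borel_measurable_AE_LIMSEQ)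
    fix i
    have "simple_function M (\<lambda>x. dist (s i x) (r i x))"
      using s(1) r(1) by (rule simple_function_compose2)
    then show "(\<lambda>x. dist (s i x) (r i x)) \<in> borel_measurable M"
      by (rule borel_measurable_simple_function)
    show "AE x in M. (\<lambda>i. dist (s i x) (r i x)) \<longlonglongrightarrow> dist (f x) (g x)"
      using s(2) r(2) by eventually_elim (rule tendsto_dist)
  qed
qed

lemma strongly_measurable_simple:
  "simple_function M s \<Longrightarrow> strongly_measurable M s"
  unfolding strongly_measurable_def by (auto intro!: exI[of _ "\<lambda>_. s"])

text \<open>The hard half of Pettis' measurability theorem, with distances to points in place of
  functionals. Enumerate the countable set as \<open>d 0, d 1, \<dots>\<close> and let \<open>s n x\<close> be the point nearest
  to \<open>f x\<close> among the first \<open>n + 1\<close>: it takes finitely many values, its level sets are cut out by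
  comparing distances, and it converges to \<open>f x\<close> by density.\<close>

lemma strongly_measurableI_separable:
  fixes f :: "'a \<Rightarrow> 'b::real_normed_vector"
  assumes meas: "\<And>c. (\<lambda>x. dist (f x) c) \<in> borel_measurable M"
    and D: "countable D" "AE x in M. f x \<in> closure D"
  shows "strongly_measurable M f"
proof -
  define d where "d = from_nat_into (insert 0 D)"
  have d: "range d = insert 0 D"
    unfolding d_def using D(1) by (intro range_from_nat_into) auto
  define s where "s = rec_nat (\<lambda>_. d 0)
    (\<lambda>n p x. if dist (f x) (d (Suc n)) < dist (f x) (p x) then d (Suc n) else p x)"
  have s0: "s 0 = (\<lambda>_. d 0)" and
    sS: "s (Suc n) = (\<lambda>x. if dist (f x) (d (Suc n)) < dist (f x) (s n x) then d (Suc n) else s n x)" for n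
    by (auto simp: s_def)
  have simple: "simple_function M (s n) \<and> (\<lambda>x. dist (f x) (s n x)) \<in> borel_measurable M" for n
  proof (induction n)
    case 0
    then show ?case using meas by (simp add: s0)
  next
    case (Suc n)
    then have [measurable]: "(\<lambda>x. dist (f x) (s n x)) \<in> borel_measurable M"
      and sn: "simple_function M (s n)" by auto
    note [measurable] = meas
    have *: "{x \<in> space M. dist (f x) (d (Suc n)) < dist (f x) (s n x)} \<in> sets M"
      by measurable
    have "simple_function M (s (Suc n))"
      unfolding sS using * sn by (intro simple_function_If simple_function_const) auto
    moreover have "(\<lambda>x. dist (f x) (s (Suc n) x)) =
        (\<lambda>x. min (dist (f x) (d (Suc n))) (dist (f x) (s n x)))"
      by (auto simp: sS min_def fun_eq_iff)
    ultimately show ?case by simp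
  qed
  have near: "dist (f x) (s n x) \<le> dist (f x) (d i)" if "i \<le> n" for n i x
    using that by (induction n) (auto simp: s0 sS le_Suc_eq)
  have "AE x in M. (\<lambda>n. s n x) \<longlonglongrightarrow> f x"
    using D(2)
  proof eventually_elim
    fix x assume x: "f x \<in> closure D"
    show "(\<lambda>n. s n x) \<longlonglongrightarrow> f x"
    proof (rule metric_LIMSEQ_I)
      fix e :: real assume "0 < e"
      with x obtain y where "y \<in> D" "dist y (f x) < e" by (auto simp: closure_approachable)
      then obtain i where "dist (f x) (d i) < e"
        using d by (metis dist_commute insertCI rangeE)
      then show "\<exists>N. \<forall>n\<ge>N. dist (s n x) (f x) < e"
        using near by (metis dist_commute le_less_trans)
    qed
  qed
  with simple show ?thesis unfolding strongly_measurable_def by blast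
qed

text \<open>The converse half: the values of the approximating simple functions form the required
  countable set.\<close>

lemma strongly_measurable_separable:
  assumes "strongly_measurable M f"
  obtains D where "countable D" "AE x in M. f x \<in> closure D"
proof -
  from assms obtain s where
    s: "\<And>i::nat. simple_function M (s i)" "AE x in M. (\<lambda>i. s i x) \<longlonglongrightarrow> f x"
    unfolding strongly_measurable_def by blast
  show ?thesis
  proof
    show "countable (\<Union>i. s i ` space M)"
      using s(1) by (auto simp: simple_function_def countable_finite)
    show "AE x in M. f x \<in> closure (\<Union>i. s i ` space M)"
      using s(2) AE_space
    proof eventually_elim
      fix x assume x: "(\<lambda>i. s i x) \<longlonglongrightarrow> f x" "x \<in> space M"
      then show "f x \<in> closure (\<Union>i. s i ` space M)"
        unfolding closure_sequential by (intro exI[of _ "\<lambda>i. s i x"]) auto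
    qed
  qed
qed

text \<open>A diagonal choice from the simple approximants of the \<open>F i\<close> would need uniform control of
  the convergence. Pettis' criterion avoids this, since measurability of distances and
  separability of the range are each visibly stable under limits.\<close>

lemma (in complete_measure) strongly_measurable_AE_LIMSEQ:
  assumes F: "\<And>i::nat. strongly_measurable M (F i)"
    and lim: "AE x in M. (\<lambda>i. F i x) \<longlonglongrightarrow> f x"
  shows "strongly_measurable M f"
proof -
  have "\<forall>i. \<exists>D. countable D \<and> (AE x in M. F i x \<in> closure D)"
    using strongly_measurable_separable[OF F] by metis
  then obtain D where D: "\<And>i. countable (D i)" "\<And>i. AE x in M. F i x \<in> closure (D i)"
    by metis
  show ?thesis
  proof (rule strongly_measurableI_separable)
    fix c
    show "(\<lambda>x. dist (f x) c) \<in> borel_measurable M"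
    proof (rule borel_measurable_AE_LIMSEQ)
      show "(\<lambda>x. dist (F i x) c) \<in> borel_measurable M" for i
        by (intro dist_strongly_measurable F strongly_measurable_simple simple_function_const)
      show "AE x in M. (\<lambda>i. dist (F i x) c) \<longlonglongrightarrow> dist (f x) c"
        using lim by eventually_elim (intro tendsto_intros)
    qed
    show "countable (\<Union>i. D i)" using D(1) by auto
    have "AE x in M. \<forall>i. F i x \<in> closure (D i)"
      using D(2) by (simp add: AE_all_countable)
    with lim show "AE x in M. f x \<in> closure (\<Union>i. D i)"
    proof eventually_elim
      fix x assume l: "(\<lambda>i. F i x) \<longlonglongrightarrow> f x" and i: "\<forall>i. F i x \<in> closure (D i)"
      have "closure (D i) \<subseteq> closure (\<Union>i. D i)" for i by (intro closure_mono) auto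
      then have "F i x \<in> closure (\<Union>i. D i)" for i using i by (meson subsetD)
      then show "f x \<in> closure (\<Union>i. D i)"
        using l by (rule closed_sequentially[OF closed_closure])
    qed
  qed
qed

lemma strongly_measurable_diff:
  assumes "strongly_measurable M f" and "strongly_measurable M g"
  shows "strongly_measurable M (\<lambda>x. f x - g x)"
proof -
  from assms obtain s r where
    s: "\<And>i::nat. simple_function M (s i)" "AE x in M. (\<lambda>i. s i x) \<longlonglongrightarrow> f x" and
    r: "\<And>i::nat. simple_function M (r i)" "AE x in M. (\<lambda>i. r i x) \<longlonglongrightarrow> g x"
    unfolding strongly_measurable_def by blast
  have "AE x in M. (\<lambda>i. s i x - r i x) \<longlonglongrightarrow> f x - g x"
    using s(2) r(2) by eventually_elim (rule tendsto_diff)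
  then show ?thesis
    unfolding strongly_measurable_def
    using simple_function_compose2[OF s(1) r(1), of minus]
    by (intro exI[of _ "\<lambda>i x. s i x - r i x"]) auto
qed

lemma strongly_measurable_bounded_linear:
  assumes "bounded_linear L" and "strongly_measurable M f"
  shows "strongly_measurable M (\<lambda>x. L (f x))"
proof -
  from assms(2) obtain s where
    s: "\<And>i::nat. simple_function M (s i)" "AE x in M. (\<lambda>i. s i x) \<longlonglongrightarrow> f x"
    unfolding strongly_measurable_def by blast
  have "AE x in M. (\<lambda>i. L (s i x)) \<longlonglongrightarrow> L (f x)"
    using s(2) by eventually_elim (rule bounded_linear.tendsto[OF assms(1)])
  then show ?thesis
    unfolding strongly_measurable_def
    using simple_function_compose1[OF s(1), of L]
    by (intro exI[of _ "\<lambda>i x. L (s i x)"]) auto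
qed

lemma strongly_measurable_distr:
  assumes T: "T \<in> measurable N M" and distr: "distr N M T = M" and f: "strongly_measurable M f"
  shows "strongly_measurable N (\<lambda>x. f (T x))"
proof -
  from f obtain s where
    s: "\<And>i::nat. simple_function M (s i)" "AE x in M. (\<lambda>i. s i x) \<longlonglongrightarrow> f x"
    unfolding strongly_measurable_def by blast
  have "AE x in N. (\<lambda>i. s i (T x)) \<longlonglongrightarrow> f (T x)"
    by (rule AE_distrD[OF T]) (use s(2) in \<open>simp only: distr\<close>)
  then show ?thesis
    unfolding strongly_measurable_def
    using simple_function_comp[OF T s(1)]
    by (intro exI[of _ "\<lambda>i x. s i (T x)"]) (auto simp: comp_def)
qed

lemma (in complete_measure) strongly_measurable_restrict_space:
  assumes S: "S \<in> sets M" and f: "strongly_measurable M f"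
  shows "strongly_measurable (restrict_space M S) f"
proof -
  obtain D where D: "countable D" "AE x in M. f x \<in> closure D"
    using strongly_measurable_separable[OF f] .
  show ?thesis
  proof (rule strongly_measurableI_separable[OF _ D(1)])
    show "(\<lambda>x. dist (f x) c) \<in> borel_measurable (restrict_space M S)" for c
      by (intro measurable_restrict_space1 dist_strongly_measurable f
          strongly_measurable_simple simple_function_const)
    show "AE x in restrict_space M S. f x \<in> closure D"
      using S D(2) by (subst AE_restrict_space_iff) auto
  qed
qed

text \<open>Local strong measurability, as contained in \<open>Lp_loc\<close>, is strong measurability: both parts of
  Pettis' criterion can be checked on the countably many intervals \<open>[-n, n]\<close>.\<close>

lemma strongly_measurable_lebesgueI:
  assumes "\<And>a b. strongly_measurable (lebesgue_on {a..b}) (f :: real \<Rightarrow> _)"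
  shows "strongly_measurable lebesgue f"
proof -
  let ?I = "\<lambda>n::nat. {- real n..real n}"
  have cover: "\<exists>n. x \<in> ?I n" for x :: real
    using real_arch_simple[of "\<bar>x\<bar>"] by (auto simp: abs_le_iff minus_le_iff)
  have "\<forall>n. \<exists>D. countable D \<and> (AE x in lebesgue_on (?I n). f x \<in> closure D)"
    using strongly_measurable_separable[OF assms] by metis
  then obtain D where D: "\<And>n. countable (D n)" "\<And>n. AE x in lebesgue_on (?I n). f x \<in> closure (D n)"
    by metis
  show ?thesis
  proof (rule strongly_measurableI_separable)
    fix c
    show "(\<lambda>x. dist (f x) c) \<in> borel_measurable lebesgue"
    proof (rule measurable_piecewise_restrict[where C = "range ?I"])
      fix \<Omega> assume "\<Omega> \<in> range ?I"
      then show "(\<lambda>x. dist (f x) c) \<in> borel_measurable (lebesgue_on \<Omega>)"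
        by (auto intro!: complete_measure.dist_strongly_measurable complete_measure_lebesgue_on
            assms strongly_measurable_simple)
    qed (use cover in auto)
    show "countable (\<Union>n. D n)" using D(1) by auto
    have "AE x in lebesgue. \<forall>n. x \<in> ?I n \<longrightarrow> f x \<in> closure (D n)"
      using D(2) by (subst AE_all_countable) (auto simp: AE_restrict_space_iff)
    then show "AE x in lebesgue. f x \<in> closure (\<Union>n. D n)"
    proof eventually_elim
      fix x assume *: "\<forall>n. x \<in> ?I n \<longrightarrow> f x \<in> closure (D n)"
      obtain n where "f x \<in> closure (D n)" using cover[of x] * by auto
      moreover have "closure (D n) \<subseteq> closure (\<Union>n. D n)" by (intro closure_mono) auto
      ultimately show "f x \<in> closure (\<Union>n. D n)" by blast
    qed
  qed
qed

section \<open>The Bochner integral of strongly measurable functions\<close>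

lemma dist_simple_integrals_le:
  fixes s r :: "'a \<Rightarrow> 'b::real_normed_vector"
  assumes s: "Bochner_Integration.simple_bochner_integrable M s" and r: "Bochner_Integration.simple_bochner_integrable M r"
  shows "ennreal (dist (Bochner_Integration.simple_bochner_integral M s) (Bochner_Integration.simple_bochner_integral M r))
    \<le> (\<integral>\<^sup>+x. ennreal (dist (s x) (r x)) \<partial>M)"
proof -
  have "dist (Bochner_Integration.simple_bochner_integral M s) (Bochner_Integration.simple_bochner_integral M r)
      = norm (Bochner_Integration.simple_bochner_integral M (\<lambda>x. s x - r x))"
    using s r by (simp add: dist_norm simple_bochner_integral_diff)
  also have "\<dots> \<le> Bochner_Integration.simple_bochner_integral M (\<lambda>x. norm (s x - r x))"
    using simple_bochner_integrable_compose2[of "(-)" M s r] s r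
    by (intro simple_bochner_integral_norm_bound) auto
  finally have "ennreal (dist (Bochner_Integration.simple_bochner_integral M s) (Bochner_Integration.simple_bochner_integral M r))
      \<le> ennreal (Bochner_Integration.simple_bochner_integral M (\<lambda>x. norm (s x - r x)))"
    by (rule ennreal_leI)
  also have "\<dots> = (\<integral>\<^sup>+x. norm (s x - r x) \<partial>M)"
    using simple_bochner_integrable_compose2[of "\<lambda>x y. norm (x - y)" M s r] s r
    by (intro simple_bochner_integral_eq_nn_integral) auto
  finally show ?thesis by (simp add: dist_norm)
qed

lemma simple_bochner_integrable_strongly_measurable:
  "Bochner_Integration.simple_bochner_integrable M s \<Longrightarrow> strongly_measurable M s"
  by (auto elim: simple_bochner_integrable.cases intro: strongly_measurable_simple)

lemma (in complete_measure) nn_integral_dist_triangle: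
  assumes "strongly_measurable M f" "strongly_measurable M g" "strongly_measurable M h"
  shows "(\<integral>\<^sup>+x. ennreal (dist (f x) (h x)) \<partial>M)
    \<le> (\<integral>\<^sup>+x. ennreal (dist (f x) (g x)) \<partial>M) + (\<integral>\<^sup>+x. ennreal (dist (g x) (h x)) \<partial>M)"
proof -
  note [measurable] = assms[THEN dist_strongly_measurable]
  have "(\<integral>\<^sup>+x. ennreal (dist (f x) (h x)) \<partial>M)
      \<le> (\<integral>\<^sup>+x. ennreal (dist (f x) (g x)) + ennreal (dist (g x) (h x)) \<partial>M)"
    by (intro nn_integral_mono) (simp add: dist_triangle flip: ennreal_plus)
  also have "\<dots> = (\<integral>\<^sup>+x. ennreal (dist (f x) (g x)) \<partial>M) + (\<integral>\<^sup>+x. ennreal (dist (g x) (h x)) \<partial>M)"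
    using assms by (intro nn_integral_add measurable_compose[OF _ measurable_ennreal] dist_strongly_measurable)
  finally show ?thesis .
qed

text \<open>The fundamental inequality \<open>\<parallel>\<integral>f - \<integral>g\<parallel> \<le> \<integral>\<parallel>f - g\<parallel>\<close>, obtained from the case of simple
  functions in the limit. For \<open>f = g\<close> it gives the uniqueness of the integral.\<close>

lemma (in complete_measure) has_Bochner_integral_dist_le:
  assumes f: "has_Bochner_integral M f y" and g: "has_Bochner_integral M g z"
  shows "ennreal (dist y z) \<le> (\<integral>\<^sup>+x. ennreal (dist (f x) (g x)) \<partial>M)" (is "_ \<le> ?I")
proof -
  from f obtain s where sf: "strongly_measurable M f"
    and s: "\<And>i::nat. Bochner_Integration.simple_bochner_integrable M (s i)"
      "(\<lambda>i. \<integral>\<^sup>+x. ennreal (dist (f x) (s i x)) \<partial>M) \<longlonglongrightarrow> 0"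
      "(\<lambda>i. Bochner_Integration.simple_bochner_integral M (s i)) \<longlonglongrightarrow> y"
    unfolding has_Bochner_integral_def dist_norm by blast
  from g obtain r where sg: "strongly_measurable M g"
    and r: "\<And>i::nat. Bochner_Integration.simple_bochner_integrable M (r i)"
      "(\<lambda>i. \<integral>\<^sup>+x. ennreal (dist (g x) (r i x)) \<partial>M) \<longlonglongrightarrow> 0"
      "(\<lambda>i. Bochner_Integration.simple_bochner_integral M (r i)) \<longlonglongrightarrow> z"
    unfolding has_Bochner_integral_def dist_norm by blast
  note sm = sf sg s(1)[THEN simple_bochner_integrable_strongly_measurable]
    r(1)[THEN simple_bochner_integrable_strongly_measurable]
  have "ennreal (dist (Bochner_Integration.simple_bochner_integral M (s i)) (Bochner_Integration.simple_bochner_integral M (r i)))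
      \<le> (\<integral>\<^sup>+x. ennreal (dist (f x) (s i x)) \<partial>M) + (?I + (\<integral>\<^sup>+x. ennreal (dist (g x) (r i x)) \<partial>M))" for i
  proof -
    have "ennreal (dist (Bochner_Integration.simple_bochner_integral M (s i)) (Bochner_Integration.simple_bochner_integral M (r i)))
        \<le> (\<integral>\<^sup>+x. ennreal (dist (s i x) (r i x)) \<partial>M)"
      using s(1) r(1) by (rule dist_simple_integrals_le)
    also have "\<dots> \<le> (\<integral>\<^sup>+x. ennreal (dist (s i x) (f x)) \<partial>M) + (\<integral>\<^sup>+x. ennreal (dist (f x) (r i x)) \<partial>M)"
      by (intro nn_integral_dist_triangle sm)
    also have "\<dots> \<le> (\<integral>\<^sup>+x. ennreal (dist (s i x) (f x)) \<partial>M) + (?I + (\<integral>\<^sup>+x. ennreal (dist (g x) (r i x)) \<partial>M))"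
      by (intro add_left_mono nn_integral_dist_triangle sm)
    finally show ?thesis by (simp add: dist_commute)
  qed
  moreover have "(\<lambda>i. ennreal (dist (Bochner_Integration.simple_bochner_integral M (s i)) (Bochner_Integration.simple_bochner_integral M (r i))))
      \<longlonglongrightarrow> ennreal (dist y z)"
    by (intro tendsto_ennrealI tendsto_dist s(3) r(3))
  moreover have "(\<lambda>i. (\<integral>\<^sup>+x. ennreal (dist (f x) (s i x)) \<partial>M) + (?I + (\<integral>\<^sup>+x. ennreal (dist (g x) (r i x)) \<partial>M)))
      \<longlonglongrightarrow> 0 + (?I + 0)"
    by (intro tendsto_add tendsto_const s(2) r(2))
  ultimately show ?thesis
    by (auto intro: LIMSEQ_le)
qed

lemma (in complete_measure) Bochner_integral_eq:
  assumes f: "has_Bochner_integral M f y"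
  shows "Bochner_integral M f = y"
  unfolding Bochner_integral_def
proof (rule the_equality)
  show "has_Bochner_integral M f y" by (rule f)
  fix z assume "has_Bochner_integral M f z"
  then have "ennreal (dist z y) \<le> (\<integral>\<^sup>+x. ennreal (dist (f x) (f x)) \<partial>M)"
    by (rule has_Bochner_integral_dist_le) (rule f)
  then show "z = y" by (simp add: ennreal_eq_0_iff)
qed

text \<open>Bochner's criterion. Cutting the simple approximants off where they exceed \<open>2 \<parallel>f\<parallel>\<close> keeps the
  pointwise convergence and provides the majorant \<open>3 \<parallel>f\<parallel>\<close> for dominated convergence; the integrals
  of the truncated functions then form a Cauchy sequence.\<close>

lemma (in complete_measure) has_Bochner_integral_exists:
  fixes f :: "'a \<Rightarrow> 'b::banach"
  assumes f: "strongly_measurable M f" and fin: "(\<integral>\<^sup>+x. ennreal (norm (f x)) \<partial>M) < \<infinity>"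
  obtains y where "has_Bochner_integral M f y"
proof -
  from f obtain s where
    s: "\<And>i::nat. simple_function M (s i)" "AE x in M. (\<lambda>i. s i x) \<longlonglongrightarrow> f x"
    unfolding strongly_measurable_def by blast
  have norm_meas: "(\<lambda>x. norm (h x)) \<in> borel_measurable M"
    if "strongly_measurable M h" for h :: "'a \<Rightarrow> 'b"
    using dist_strongly_measurable[OF that strongly_measurable_simple[OF simple_function_const[of M 0]]]
    by simp
  note [measurable] = norm_meas[OF f] norm_meas[OF strongly_measurable_simple[OF s(1)]]
  define t where "t i x = (if norm (s i x) \<le> 2 * norm (f x) then s i x else 0)" for i x
  have tsimple: "simple_function M (t i)" for i
    unfolding t_def by (intro simple_function_If simple_function_const s(1)) measurable
  have tmeas: "strongly_measurable M (t i)" for i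
    by (rule strongly_measurable_simple[OF tsimple])
  have tle: "norm (t i x) \<le> 2 * norm (f x)" for i x
    by (simp add: t_def)
  have fin2: "(\<integral>\<^sup>+x. ennreal (c * norm (f x)) \<partial>M) < \<infinity>" if "0 \<le> c" for c
    using that fin by (simp add: ennreal_mult nn_integral_cmult ennreal_mult_less_top)
  have tint: "Bochner_Integration.simple_bochner_integrable M (t i)" for i
  proof (rule simple_bochner_integrableI_bounded[OF tsimple])
    have "(\<integral>\<^sup>+x. ennreal (norm (t i x)) \<partial>M) \<le> (\<integral>\<^sup>+x. ennreal (2 * norm (f x)) \<partial>M)"
      using tle by (intro nn_integral_mono ennreal_leI) auto
    with fin2[of 2] show "(\<integral>\<^sup>+x. ennreal (norm (t i x)) \<partial>M) < \<infinity>" by simp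
  qed
  have tlim: "AE x in M. (\<lambda>i. t i x) \<longlonglongrightarrow> f x"
    using s(2)
  proof eventually_elim
    fix x assume lim: "(\<lambda>i. s i x) \<longlonglongrightarrow> f x"
    show "(\<lambda>i. t i x) \<longlonglongrightarrow> f x"
    proof (cases "f x = 0")
      case True
      then have "t i x = 0" for i by (simp add: t_def)
      with True show ?thesis by simp
    next
      case False
      then have "norm (f x) < 2 * norm (f x)" by simp
      then have "\<forall>\<^sub>F i in sequentially. norm (s i x) < 2 * norm (f x)"
        by (rule order_tendstoD(2)[OF tendsto_norm[OF lim]])
      then have "\<forall>\<^sub>F i in sequentially. s i x = t i x"
        by eventually_elim (simp add: t_def)
      with lim show ?thesis by (rule Lim_transform_eventually)
    qed
  qed
  have lim0: "(\<lambda>i. \<integral>\<^sup>+x. ennreal (dist (f x) (t i x)) \<partial>M) \<longlonglongrightarrow> (\<integral>\<^sup>+x. 0 \<partial>M)"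
  proof (rule nn_integral_dominated_convergence[where w = "\<lambda>x. ennreal (3 * norm (f x))"])
    show "(\<lambda>x. ennreal (dist (f x) (t i x))) \<in> borel_measurable M" for i
      by (intro measurable_compose[OF _ measurable_ennreal] dist_strongly_measurable f tmeas)
    show "AE x in M. ennreal (dist (f x) (t i x)) \<le> ennreal (3 * norm (f x))" for i
    proof (intro AE_I2 ennreal_leI)
      fix x
      have "dist (f x) (t i x) \<le> norm (f x) + norm (t i x)"
        unfolding dist_norm by (rule norm_triangle_ineq4)
      with tle[of i x] show "dist (f x) (t i x) \<le> 3 * norm (f x)" by simp
    qed
    show "(\<integral>\<^sup>+x. ennreal (3 * norm (f x)) \<partial>M) < \<infinity>" by (rule fin2) simp
    show "AE x in M. (\<lambda>i. ennreal (dist (f x) (t i x))) \<longlonglongrightarrow> 0"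
      using tlim
    proof eventually_elim
      fix x assume "(\<lambda>i. t i x) \<longlonglongrightarrow> f x"
      then have "(\<lambda>i. ennreal (dist (f x) (t i x))) \<longlonglongrightarrow> ennreal (dist (f x) (f x))"
        by (intro tendsto_ennrealI tendsto_intros)
      then show "(\<lambda>i. ennreal (dist (f x) (t i x))) \<longlonglongrightarrow> 0" by simp
    qed
  qed auto
  have "Cauchy (\<lambda>i. Bochner_Integration.simple_bochner_integral M (t i))"
  proof (rule metric_CauchyI)
    fix e :: real assume "0 < e"
    then have "\<forall>\<^sub>F i in sequentially. (\<integral>\<^sup>+x. ennreal (dist (f x) (t i x)) \<partial>M) < ennreal (e / 2)"
      using order_tendstoD(2)[OF lim0, of "ennreal (e / 2)"] by simp
    then obtain N where N: "\<And>i. N \<le> i \<Longrightarrow> (\<integral>\<^sup>+x. ennreal (dist (f x) (t i x)) \<partial>M) < ennreal (e / 2)"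
      unfolding eventually_sequentially by blast
    have "dist (Bochner_Integration.simple_bochner_integral M (t i)) (Bochner_Integration.simple_bochner_integral M (t j)) < e"
      if "N \<le> i" "N \<le> j" for i j
    proof -
      have "ennreal (dist (Bochner_Integration.simple_bochner_integral M (t i)) (Bochner_Integration.simple_bochner_integral M (t j)))
          \<le> (\<integral>\<^sup>+x. ennreal (dist (t i x) (t j x)) \<partial>M)"
        by (intro dist_simple_integrals_le tint)
      also have "\<dots> \<le> (\<integral>\<^sup>+x. ennreal (dist (t i x) (f x)) \<partial>M) + (\<integral>\<^sup>+x. ennreal (dist (f x) (t j x)) \<partial>M)"
        by (intro nn_integral_dist_triangle f tmeas)
      also have "\<dots> < ennreal (e / 2) + ennreal (e / 2)"
        using N[OF that(1)] N[OF that(2)] by (intro add_strict_mono) (simp_all add: dist_commute)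
      also have "\<dots> = ennreal e" using \<open>0 < e\<close> by (simp flip: ennreal_plus)
      finally show ?thesis by (simp add: ennreal_less_iff)
    qed
    then show "\<exists>N. \<forall>i\<ge>N. \<forall>j\<ge>N.
        dist (Bochner_Integration.simple_bochner_integral M (t i)) (Bochner_Integration.simple_bochner_integral M (t j)) < e"
      by blast
  qed
  then obtain y where "(\<lambda>i. Bochner_Integration.simple_bochner_integral M (t i)) \<longlonglongrightarrow> y"
    using Cauchy_convergent convergent_def by blast
  with f tint lim0 have "has_Bochner_integral M f y"
    unfolding has_Bochner_integral_def dist_norm by auto
  then show thesis ..
qed

lemma (in complete_measure) has_Bochner_integral_bounded_linear:
  assumes L: "bounded_linear L" and f: "has_Bochner_integral M f y"
  shows "has_Bochner_integral M (\<lambda>x. L (f x)) (L y)"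
proof -
  interpret L: bounded_linear L by fact
  from f obtain s where sf: "strongly_measurable M f"
    and s: "\<And>i::nat. Bochner_Integration.simple_bochner_integrable M (s i)"
      "(\<lambda>i. \<integral>\<^sup>+x. ennreal (norm (f x - s i x)) \<partial>M) \<longlonglongrightarrow> 0"
      "(\<lambda>i. Bochner_Integration.simple_bochner_integral M (s i)) \<longlonglongrightarrow> y"
    unfolding has_Bochner_integral_def by blast
  obtain K where K: "0 \<le> K" "\<And>x. norm (L x) \<le> norm x * K"
    using L.nonneg_bounded by blast
  show ?thesis
    unfolding has_Bochner_integral_def
  proof (intro conjI exI allI)
    show "strongly_measurable M (\<lambda>x. L (f x))"
      by (rule strongly_measurable_bounded_linear[OF L sf])
    show "Bochner_Integration.simple_bochner_integrable M (\<lambda>x. L (s i x))" for i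
      using simple_bochner_integrable_compose2[of "\<lambda>x y. L x", OF L.zero s(1) s(1)] by simp
    have le: "(\<integral>\<^sup>+x. ennreal (norm (L (f x) - L (s i x))) \<partial>M)
        \<le> ennreal K * (\<integral>\<^sup>+x. ennreal (norm (f x - s i x)) \<partial>M)" for i
    proof -
      have "(\<integral>\<^sup>+x. ennreal (norm (L (f x) - L (s i x))) \<partial>M)
          \<le> (\<integral>\<^sup>+x. ennreal K * ennreal (dist (f x) (s i x)) \<partial>M)"
      proof (intro nn_integral_mono)
        fix x
        have "norm (L (f x) - L (s i x)) \<le> K * dist (f x) (s i x)"
          using K(2)[of "f x - s i x"] by (simp add: L.diff dist_norm mult.commute)
        then show "ennreal (norm (L (f x) - L (s i x))) \<le> ennreal K * ennreal (dist (f x) (s i x))"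
          using K(1) by (simp add: ennreal_leI flip: ennreal_mult)
      qed
      also have "\<dots> = ennreal K * (\<integral>\<^sup>+x. ennreal (dist (f x) (s i x)) \<partial>M)"
        by (intro nn_integral_cmult measurable_compose[OF _ measurable_ennreal]
            dist_strongly_measurable sf simple_bochner_integrable_strongly_measurable s(1))
      finally show ?thesis by (simp add: dist_norm)
    qed
    have "(\<lambda>i. ennreal K * (\<integral>\<^sup>+x. ennreal (norm (f x - s i x)) \<partial>M)) \<longlonglongrightarrow> ennreal K * 0"
      using s(2) by (intro ennreal_tendsto_cmult) auto
    then have lim: "(\<lambda>i. ennreal K * (\<integral>\<^sup>+x. ennreal (norm (f x - s i x)) \<partial>M)) \<longlonglongrightarrow> 0"
      by simp
    show "(\<lambda>i. \<integral>\<^sup>+x. ennreal (norm (L (f x) - L (s i x))) \<partial>M) \<longlonglongrightarrow> 0"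
      by (rule tendsto_sandwich[OF always_eventually always_eventually tendsto_const lim])
        (intro allI zero_le le)+
    show "(\<lambda>i. Bochner_Integration.simple_bochner_integral M (\<lambda>x. L (s i x))) \<longlonglongrightarrow> L y"
      using L.tendsto[OF s(3)] s(1) by (simp add: simple_bochner_integral_linear L.linear_axioms)
  qed
qed

text \<open>\<open>T\<close> may miss some values of \<open>s\<close>, but the corresponding level sets are null sets and
  contribute nothing to the sum.\<close>

lemma simple_bochner_integral_distr:
  assumes T: "T \<in> measurable N M" and distr: "distr N M T = M"
    and s: "Bochner_Integration.simple_bochner_integrable M s"
  shows "Bochner_Integration.simple_bochner_integrable N (\<lambda>x. s (T x))"
    and "Bochner_Integration.simple_bochner_integral N (\<lambda>x. s (T x)) = Bochner_Integration.simple_bochner_integral M s"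
proof -
  have sf: "simple_function M s" and fin: "emeasure M {y\<in>space M. s y \<noteq> 0} \<noteq> \<infinity>"
    using s by (auto elim: simple_bochner_integrable.cases)
  have [measurable]: "s \<in> measurable M (count_space UNIV)" by (rule measurable_simple_function[OF sf])
  note [measurable] = T
  have vim: "T -` {y \<in> space M. P y} \<inter> space N = {x \<in> space N. P (T x)}" for P
    using measurable_space[OF T] by auto
  have em: "emeasure N {x \<in> space N. P (s (T x))} = emeasure M {x \<in> space M. P (s x)}" for P
  proof -
    have "emeasure M {x \<in> space M. P (s x)} = emeasure (distr N M T) {x \<in> space M. P (s x)}"
      by (simp only: distr)
    also have "\<dots> = emeasure N (T -` {x \<in> space M. P (s x)} \<inter> space N)"
    proof (rule emeasure_distr[OF T])
      have "s -` Collect P \<inter> space M \<in> sets M"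
        using measurable_simple_function[OF sf] by (rule measurable_sets) auto
      then show "{x \<in> space M. P (s x)} \<in> sets M" by (simp add: vimage_def Int_def conj_commute)
    qed
    finally show ?thesis unfolding vim by simp
  qed
  have me: "measure N {x \<in> space N. s (T x) = c} = measure M {x \<in> space M. s x = c}" for c
    using em[of "\<lambda>x. x = c"] by (simp add: measure_def)
  show "Bochner_Integration.simple_bochner_integrable N (\<lambda>x. s (T x))"
    using simple_function_comp[OF T sf] fin em[of "\<lambda>x. x \<noteq> 0"]
    by (intro simple_bochner_integrable.intros) (auto simp: comp_def)
  have sub: "(\<lambda>x. s (T x)) ` space N \<subseteq> s ` space M"
    using measurable_space[OF T] by auto
  have "Bochner_Integration.simple_bochner_integral N (\<lambda>x. s (T x))
      = (\<Sum>y\<in>s ` space M. measure N {x\<in>space N. s (T x) = y} *\<^sub>R y)"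
    unfolding simple_bochner_integral_def
  proof (rule sum.mono_neutral_left[OF _ sub])
    show "finite (s ` space M)" using sf by (simp add: simple_function_def)
    show "\<forall>y\<in>s ` space M - (\<lambda>x. s (T x)) ` space N. measure N {x \<in> space N. s (T x) = y} *\<^sub>R y = 0"
    proof
      fix y assume "y \<in> s ` space M - (\<lambda>x. s (T x)) ` space N"
      then have empty: "{x \<in> space N. s (T x) = y} = {}" by blast
      show "measure N {x \<in> space N. s (T x) = y} *\<^sub>R y = 0" unfolding empty by simp
    qed
  qed
  then show "Bochner_Integration.simple_bochner_integral N (\<lambda>x. s (T x)) = Bochner_Integration.simple_bochner_integral M s"
    by (simp add: me simple_bochner_integral_def)
qed

lemma (in complete_measure) has_Bochner_integral_distr:
  assumes T: "T \<in> measurable N M" and distr: "distr N M T = M"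
    and f: "has_Bochner_integral M f y"
  shows "has_Bochner_integral N (\<lambda>x. f (T x)) y"
proof -
  from f obtain s where sf: "strongly_measurable M f"
    and s: "\<And>i::nat. Bochner_Integration.simple_bochner_integrable M (s i)"
      "(\<lambda>i. \<integral>\<^sup>+x. ennreal (dist (f x) (s i x)) \<partial>M) \<longlonglongrightarrow> 0"
      "(\<lambda>i. Bochner_Integration.simple_bochner_integral M (s i)) \<longlonglongrightarrow> y"
    unfolding has_Bochner_integral_def dist_norm by blast
  have "(\<integral>\<^sup>+x. ennreal (dist (f (T x)) (s i (T x))) \<partial>N)
      = (\<integral>\<^sup>+x. ennreal (dist (f x) (s i x)) \<partial>distr N M T)" for i
    by (intro nn_integral_distr[symmetric] T measurable_compose[OF _ measurable_ennreal])
      (simp add: distr dist_strongly_measurable sf simple_bochner_integrable_strongly_measurable s(1))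
  then show ?thesis
    unfolding has_Bochner_integral_def dist_norm[symmetric]
    using s simple_bochner_integral_distr[OF T distr s(1)] strongly_measurable_distr[OF T distr sf]
    by (intro conjI exI[of _ "\<lambda>i x. s i (T x)"]) (auto simp: distr)
qed

section \<open>Lebesgue seminorms and Hoelder's inequality\<close>

text \<open>This removes the roots, the \<open>enn2real\<close> and the case distinction in \<open>Lp_norm\<close> from all later
  estimates.\<close>

lemma Lp_norm_le_iff:
  assumes q: "0 < q" and A: "0 \<le> A"
  shows "Lp_norm (ennreal q) M f \<le> ennreal A
    \<longleftrightarrow> (\<integral>\<^sup>+x. ennreal (norm (f x) powr q) \<partial>M) \<le> ennreal (A powr q)"
proof (cases "(\<integral>\<^sup>+x. ennreal (norm (f x) powr q) \<partial>M)")
  case top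
  then show ?thesis using q by (simp add: Lp_norm_def top_unique)
next
  case (real i)
  have "i powr (1 / q) \<le> A \<longleftrightarrow> i \<le> A powr q"
  proof
    assume "i powr (1 / q) \<le> A"
    then have "(i powr (1 / q)) powr q \<le> A powr q" using q by (intro powr_mono2) auto
    with q real show "i \<le> A powr q" by (simp add: powr_powr)
  next
    assume "i \<le> A powr q"
    then have "i powr (1 / q) \<le> (A powr q) powr (1 / q)" using q real by (intro powr_mono2) auto
    with q A show "i powr (1 / q) \<le> A" by (simp add: powr_powr)
  qed
  with real q A show ?thesis by (simp add: Lp_norm_def)
qed

lemma Lp_norm_eq_0_AE:
  assumes q: "0 < q" and f: "(\<lambda>x. norm (f x)) \<in> borel_measurable M"
    and 0: "Lp_norm (ennreal q) M f = 0"
  shows "AE x in M. f x = 0"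
proof -
  note [measurable] = f
  have "(\<integral>\<^sup>+x. ennreal (norm (f x) powr q) \<partial>M) = 0"
    using Lp_norm_le_iff[OF q, of 0 M f] 0 q by simp
  then show ?thesis
    by (subst (asm) nn_integral_0_iff_AE) (auto simp: ennreal_eq_0_iff elim!: eventually_mono)
qed

lemma (in complete_measure) norm_strongly_measurable:
  assumes "strongly_measurable M f"
  shows "(\<lambda>x. norm (f x)) \<in> borel_measurable M"
  using dist_strongly_measurable[OF assms strongly_measurable_simple[OF simple_function_const[of M 0]]]
  by simp

text \<open>A crude substitute for Minkowski's inequality, sufficient wherever only finiteness or
  boundedness matters. It comes from \<open>\<parallel>u - v\<parallel>\<^sup>q \<le> 2\<^sup>q (\<parallel>u\<parallel>\<^sup>q + \<parallel>v\<parallel>\<^sup>q)\<close> and \<open>2 \<le> 2\<^sup>q\<close>.\<close>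

lemma (in complete_measure) Lp_norm_diff_le:
  assumes q: "1 \<le> q" and A: "0 \<le> A"
    and f: "strongly_measurable M f" "Lp_norm (ennreal q) M f \<le> ennreal A"
    and g: "strongly_measurable M g" "Lp_norm (ennreal q) M g \<le> ennreal A"
  shows "Lp_norm (ennreal q) M (\<lambda>x. f x - g x) \<le> ennreal (4 * A)"
proof -
  note [measurable] = norm_strongly_measurable[OF f(1)] norm_strongly_measurable[OF g(1)]
  have q0: "0 < q" using q by simp
  have pw: "norm (f x - g x) powr q \<le> 2 powr q * norm (f x) powr q + 2 powr q * norm (g x) powr q" for x
  proof -
    have "norm (f x - g x) \<le> 2 * max (norm (f x)) (norm (g x))"
      using norm_triangle_ineq4[of "f x" "g x"] by linarith
    then have "norm (f x - g x) powr q \<le> (2 * max (norm (f x)) (norm (g x))) powr q"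
      using q0 by (intro powr_mono2) auto
    also have "\<dots> = 2 powr q * max (norm (f x)) (norm (g x)) powr q"
      by (simp add: powr_mult)
    also have "\<dots> \<le> 2 powr q * (norm (f x) powr q + norm (g x) powr q)"
      by (intro mult_left_mono) (auto simp: max_def)
    finally show ?thesis by (simp add: algebra_simps)
  qed
  have "(\<integral>\<^sup>+x. ennreal (norm (f x - g x) powr q) \<partial>M)
      \<le> (\<integral>\<^sup>+x. ennreal (2 powr q) * ennreal (norm (f x) powr q)
            + ennreal (2 powr q) * ennreal (norm (g x) powr q) \<partial>M)"
    using pw by (intro nn_integral_mono) (auto intro!: ennreal_leI simp flip: ennreal_mult ennreal_plus)
  also have "\<dots> = ennreal (2 powr q) * (\<integral>\<^sup>+x. ennreal (norm (f x) powr q) \<partial>M)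
      + ennreal (2 powr q) * (\<integral>\<^sup>+x. ennreal (norm (g x) powr q) \<partial>M)"
    by (simp add: nn_integral_add nn_integral_cmult)
  also have "\<dots> \<le> ennreal (2 powr q) * ennreal (A powr q) + ennreal (2 powr q) * ennreal (A powr q)"
    using f(2) g(2) by (intro add_mono mult_left_mono) (simp_all add: Lp_norm_le_iff[OF q0 A])
  also have "\<dots> = ennreal (2 * (2 powr q * A powr q))"
    by (simp flip: ennreal_mult ennreal_plus)
  also have "\<dots> \<le> ennreal ((4 * A) powr q)"
  proof (rule ennreal_leI)
    have "2 \<le> (2::real) powr q" using powr_mono[of 1 q "2::real"] q by simp
    then have "2 * (2 powr q * A powr q) \<le> 2 powr q * (2 powr q * A powr q)"
      by (intro mult_right_mono) auto
    also have "\<dots> = (4 * A) powr q"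
      using A powr_mult[of 2 2 q] by (simp add: powr_mult)
    finally show "2 * (2 powr q * A powr q) \<le> (4 * A) powr q" .
  qed
  finally show ?thesis using A by (subst Lp_norm_le_iff[OF q0]) auto
qed

text \<open>Young's inequality for \<open>\<parallel>f x\<parallel> / a\<close> and \<open>\<parallel>g x\<parallel> / b\<close>, multiplied by \<open>a b\<close> and integrated.\<close>

lemma Holder_finite:
  assumes rq: "1 < r" "1 < q" "1 / r + 1 / q = 1" and ab: "0 < a" "0 < b"
    and f: "(\<lambda>x. norm (f x)) \<in> borel_measurable M" "Lp_norm (ennreal r) M f \<le> ennreal a"
    and g: "(\<lambda>x. norm (g x)) \<in> borel_measurable M" "Lp_norm (ennreal q) M g \<le> ennreal b"
  shows "(\<integral>\<^sup>+x. ennreal (norm (f x) * norm (g x)) \<partial>M) \<le> ennreal (a * b)"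
proof -
  note [measurable] = f(1) g(1)
  \<comment> \<open>The weights bound the two integrated terms by \<open>a b / r\<close> and \<open>a b / q\<close>.\<close>
  define c d where "c = a * b / (r * a powr r)" and "d = a * b / (q * b powr q)"
  have cd: "0 \<le> c" "0 \<le> d" using rq ab by (auto simp: c_def d_def)
  have pw: "norm (f x) * norm (g x) \<le> c * norm (f x) powr r + d * norm (g x) powr q" for x
  proof -
    have "norm (f x) / a * (norm (g x) / b)
        \<le> (norm (f x) / a) powr r / r + (norm (g x) / b) powr q / q"
      using rq ab by (intro Youngs_inequality) auto
    then have "a * b * (norm (f x) / a * (norm (g x) / b))
        \<le> a * b * ((norm (f x) / a) powr r / r + (norm (g x) / b) powr q / q)"
      using ab by (intro mult_left_mono) auto
    also have "a * b * (norm (f x) / a * (norm (g x) / b)) = norm (f x) * norm (g x)"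
      using ab by simp
    also have "a * b * ((norm (f x) / a) powr r / r + (norm (g x) / b) powr q / q)
        = c * norm (f x) powr r + d * norm (g x) powr q"
      using ab by (simp add: c_def d_def powr_divide ring_distribs mult.commute)
    finally show ?thesis .
  qed
  have "(\<integral>\<^sup>+x. ennreal (norm (f x) * norm (g x)) \<partial>M)
      \<le> (\<integral>\<^sup>+x. ennreal c * ennreal (norm (f x) powr r) + ennreal d * ennreal (norm (g x) powr q) \<partial>M)"
    using pw cd by (intro nn_integral_mono) (auto intro!: ennreal_leI simp flip: ennreal_mult ennreal_plus)
  also have "\<dots> = ennreal c * (\<integral>\<^sup>+x. ennreal (norm (f x) powr r) \<partial>M)
      + ennreal d * (\<integral>\<^sup>+x. ennreal (norm (g x) powr q) \<partial>M)"
    by (simp add: nn_integral_add nn_integral_cmult)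
  also have "\<dots> \<le> ennreal c * ennreal (a powr r) + ennreal d * ennreal (b powr q)"
    using f(2) g(2) rq ab by (intro add_mono mult_left_mono) (simp_all add: Lp_norm_le_iff)
  also have "\<dots> = ennreal (c * a powr r + d * b powr q)"
    using cd by (simp flip: ennreal_mult ennreal_plus)
  also have "c * a powr r + d * b powr q = a * b * (1 / r + 1 / q)"
    using ab rq(1,2) by (simp add: c_def d_def ring_distribs)
  finally show ?thesis by (simp only: rq(3) mult_1_right)
qed

lemma conjugate_exponent_cases:
  assumes q: "1 \<le> q" and conj: "1 / q' + 1 / ennreal q = 1"
  obtains "q = 1" "q' = \<infinity>"
    | r where "1 < q" "q' = ennreal r" "1 < r" "1 / r + 1 / q = 1"
proof (cases "q = 1")
  case True
  with conj have "1 + 1 / q' = 1 + (0::ennreal)" by (simp add: add.commute)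
  then have "1 / q' = 0" by (simp only: ennreal_add_left_cancel) auto
  then have "q' = \<infinity>" by (simp add: ennreal_divide_eq_0_iff)
  with True that(1) show ?thesis by simp
next
  case False
  with q have q1: "1 < q" by simp
  have iq: "1 / ennreal q = ennreal (1 / q)"
    using q1 divide_ennreal[of 1 q] by simp
  show ?thesis
  proof (cases q')
    case top
    with conj iq have "ennreal (1 / q) = ennreal 1" by simp
    with q1 show ?thesis by (subst (asm) ennreal_inj) auto
  next
    case (real r)
    have "r \<noteq> 0" using conj real by auto
    with real have r: "0 < r" by simp
    then have "1 / q' = ennreal (1 / r)"
      using real divide_ennreal[of 1 r] by simp
    with conj iq r q1 have "ennreal (1 / r + 1 / q) = ennreal 1" by simp
    then have sum: "1 / r + 1 / q = 1" using r q1 by (subst (asm) ennreal_inj) auto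
    then have "1 / r < 1" using q1 by (smt (verit) zero_less_divide_1_iff)
    with r have "1 < r" by simp
    with sum real q1 that(2) show ?thesis by blast
  qed
qed

text \<open>Only the value 0 of one factor needs separate care: then that function vanishes a.e., which
  also settles the product \<open>0 * \<infinity>\<close>. For \<open>q = 1\<close> the essential supremum bounds the first factor.\<close>

lemma Holder_inequality:
  assumes q: "1 \<le> q" and conj: "1 / q' + 1 / ennreal q = 1"
    and f: "(\<lambda>x. norm (f x)) \<in> borel_measurable M"
    and g: "(\<lambda>x. norm (g x)) \<in> borel_measurable M"
  shows "(\<integral>\<^sup>+x. ennreal (norm (f x) * norm (g x)) \<partial>M) \<le> Lp_norm q' M f * Lp_norm (ennreal q) M g"
  using q conj
proof (cases rule: conjugate_exponent_cases)
  case 1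
  note [measurable] = f g
  have "(\<integral>\<^sup>+x. ennreal (norm (f x) * norm (g x)) \<partial>M)
      \<le> (\<integral>\<^sup>+x. esssup M (\<lambda>x. ennreal (norm (f x))) * ennreal (norm (g x)) \<partial>M)"
    using esssup_AE[of "\<lambda>x. ennreal (norm (f x))" M]
    by (intro nn_integral_mono_AE, eventually_elim) (auto simp: ennreal_mult intro: mult_right_mono)
  also have "\<dots> = esssup M (\<lambda>x. ennreal (norm (f x))) * (\<integral>\<^sup>+x. ennreal (norm (g x)) \<partial>M)"
    by (simp add: nn_integral_cmult)
  also have "(\<integral>\<^sup>+x. ennreal (norm (g x)) \<partial>M) = Lp_norm (ennreal q) M g"
    using 1 by (cases "\<integral>\<^sup>+x. ennreal (norm (g x)) \<partial>M") (auto simp: Lp_norm_def Let_def)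
  finally show ?thesis using 1 by (simp add: Lp_norm_def)
next
  case (2 r)
  have zero: "(\<integral>\<^sup>+x. ennreal (norm (f x) * norm (g x)) \<partial>M) = 0"
    if "(AE x in M. f x = 0) \<or> (AE x in M. g x = 0)"
  proof -
    from that have "AE x in M. ennreal (norm (f x) * norm (g x)) = 0"
      by (auto elim: eventually_mono)
    then have "(\<integral>\<^sup>+x. ennreal (norm (f x) * norm (g x)) \<partial>M) = (\<integral>\<^sup>+x. 0 \<partial>M)"
      by (rule nn_integral_cong_AE)
    then show ?thesis by simp
  qed
  show ?thesis
  proof (cases "Lp_norm q' M f = 0 \<or> Lp_norm (ennreal q) M g = 0")
    case True
    then have "(AE x in M. f x = 0) \<or> (AE x in M. g x = 0)"
      using Lp_norm_eq_0_AE[of r f M] Lp_norm_eq_0_AE[of q g M] 2 f g by auto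
    from zero[OF this] show ?thesis by simp
  next
    case nz: False
    show ?thesis
    proof (cases "Lp_norm q' M f = \<infinity> \<or> Lp_norm (ennreal q) M g = \<infinity>")
      case True
      with nz show ?thesis by (auto simp: ennreal_mult_eq_top_iff)
    next
      case False
      then obtain a b where ab: "0 \<le> a" "0 \<le> b"
        "Lp_norm q' M f = ennreal a" "Lp_norm (ennreal q) M g = ennreal b"
        by (metis ennreal_cases infinity_ennreal_def)
      with nz have "0 < a" "0 < b" by (auto simp: less_le)
      then have "(\<integral>\<^sup>+x. ennreal (norm (f x) * norm (g x)) \<partial>M) \<le> ennreal (a * b)"
        using 2 ab f g by (intro Holder_finite[of r q]) auto
      with ab show ?thesis by (simp add: ennreal_mult)
    qed
  qed
qed

section \<open>Reflections and translations of the real line\<close>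

lemma distr_lebesgue_reflect: "distr lebesgue lebesgue (\<lambda>x. t - x) = (lebesgue :: real measure)"
  using lebesgue_real_affine[of "-1" t] by (simp add: density_1)

lemma distr_lebesgue_translate: "distr lebesgue lebesgue (\<lambda>x. t + x) = (lebesgue :: real measure)"
  using lebesgue_real_affine[of 1 t] by (simp add: density_1)

lemma measurable_lebesgue_reflect: "(\<lambda>x. t - x) \<in> measurable lebesgue (lebesgue :: real measure)"
  using lebesgue_affine_measurable[of "\<lambda>_. - 1" t] by simp

lemma measurable_lebesgue_translate: "(\<lambda>x. t + x) \<in> measurable lebesgue (lebesgue :: real measure)"
  using lebesgue_affine_measurable[of "\<lambda>_. 1" t] by simp

text \<open>The substitution \<open>r = t - s\<close> that brings the integrals defining \<open>G t\<close>, for all \<open>t\<close>, onto the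
  same half-line, where they can be subtracted.\<close>

lemma lebesgue_on_reflect:
  fixes t :: real
  shows "(\<lambda>s. t - s) \<in> measurable (lebesgue_on {..<t}) (lebesgue_on {0<..})"
    and "distr (lebesgue_on {..<t}) (lebesgue_on {0<..}) (\<lambda>s. t - s) = lebesgue_on {0<..}"
proof -
  show meas: "(\<lambda>s. t - s) \<in> measurable (lebesgue_on {..<t}) (lebesgue_on {0<..})"
    by (intro measurable_restrict_space3 measurable_lebesgue_reflect) auto
  show "distr (lebesgue_on {..<t}) (lebesgue_on {0<..}) (\<lambda>s. t - s) = lebesgue_on {0<..}"
  proof (rule measure_eqI)
    fix A assume "A \<in> sets (distr (lebesgue_on {..<t}) (lebesgue_on {0<..}) (\<lambda>s. t - s))"
    then have A: "A \<in> sets (lebesgue_on {0<..})" by simp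
    then have A': "A \<in> sets lebesgue" "A \<subseteq> {0<..}" by (auto simp: sets_restrict_space_iff)
    then have pre: "(\<lambda>s. t - s) -` A \<subseteq> {..<t}" by auto
    have "emeasure (distr (lebesgue_on {..<t}) (lebesgue_on {0<..}) (\<lambda>s. t - s)) A
        = emeasure (lebesgue_on {..<t}) ((\<lambda>s. t - s) -` A)"
      using pre by (subst emeasure_distr[OF meas A]) (simp add: Int_absorb2)
    also have "\<dots> = emeasure lebesgue ((\<lambda>s. t - s) -` A)"
      using pre by (intro emeasure_restrict_space) auto
    also have "\<dots> = emeasure (distr lebesgue lebesgue (\<lambda>s. t - s)) A"
      using A' by (subst emeasure_distr[OF measurable_lebesgue_reflect]) auto
    also have "\<dots> = emeasure (lebesgue_on {0<..}) A"
      using A' by (simp add: distr_lebesgue_reflect emeasure_restrict_space)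
    finally show "emeasure (distr (lebesgue_on {..<t}) (lebesgue_on {0<..}) (\<lambda>s. t - s)) A
        = emeasure (lebesgue_on {0<..}) A" .
  qed simp
qed

text \<open>The substitution \<open>s = a + 1 - r\<close>. The right-hand side is the norm of \<open>hat h (t - a - 1)\<close>,
  the form in which the Stepanov class measures \<open>h\<close>.\<close>

lemma Lp_norm_reflect:
  fixes h :: "real \<Rightarrow> 'e::real_normed_vector"
  assumes q: "0 < q" and h: "strongly_measurable lebesgue h"
  shows "Lp_norm (ennreal q) (lebesgue_on {a..a + 1}) (\<lambda>r. h (t - r))
    = Lp_norm (ennreal q) (lebesgue_on {0..1}) (\<lambda>s. h (t - a - 1 + s))"
proof -
  note [measurable] = completion.norm_strongly_measurable[OF
      strongly_measurable_distr[OF measurable_lebesgue_translate distr_lebesgue_translate h], of "t - a - 1"]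
  let ?F = "\<lambda>x. ennreal (norm (h (t - a - 1 + x)) powr q) * indicator {0..1} x"
  have "(\<integral>\<^sup>+s. ennreal (norm (h (t - a - 1 + s)) powr q) \<partial>lebesgue_on {0..1}) = (\<integral>\<^sup>+x. ?F x \<partial>lebesgue)"
    by (simp add: nn_integral_restrict_space)
  also have "\<dots> = ennreal \<bar>- 1\<bar> * (\<integral>\<^sup>+x. ?F (a + 1 + (- 1) * x) \<partial>lebesgue)"
  proof (rule nn_integral_real_affine_lebesgue)
    have "(\<lambda>x. ennreal (norm (h (t - a - 1 + x)) powr q)) \<in> borel_measurable lebesgue"
      by measurable
    then show "?F \<in> borel_measurable lebesgue"
      by (intro borel_measurable_times_ennreal borel_measurable_indicator) auto
  qed simp
  also have "\<dots> = (\<integral>\<^sup>+x. ennreal (norm (h (t - x)) powr q) * indicator {a..a + 1} x \<partial>lebesgue)"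
    by (auto intro!: nn_integral_cong simp: indicator_def)
  also have "\<dots> = (\<integral>\<^sup>+x. ennreal (norm (h (t - x)) powr q) \<partial>lebesgue_on {a..a + 1})"
    by (simp add: nn_integral_restrict_space)
  finally show ?thesis using q by (simp add: Lp_norm_def)
qed

section \<open>Measurability of strongly continuous operator families\<close>

text \<open>The operator norm is the supremum of the continuous functions \<open>\<parallel>R t x\<parallel> / \<parallel>x\<parallel>\<close> over \<open>x \<noteq> 0\<close>,
  hence lower semicontinuous on the open half-line, however large the space is. The value at 0 is
  arbitrary and concerns a null set only.\<close>

lemma strongly_continuous_norm_measurable:
  fixes R :: "real \<Rightarrow> 'e::complex_banach \<Rightarrow>\<^sub>L 'x::complex_banach"
  assumes R: "strongly_continuous_family R" and S: "S \<in> sets lebesgue" "S \<subseteq> {0..}"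
  shows "(\<lambda>t. norm (R t)) \<in> borel_measurable (lebesgue_on S)"
proof -
  have cont: "continuous_on {0<..} (\<lambda>t. norm (blinfun_apply (R t) x))" for x
    using R by (auto simp: strongly_continuous_family_def intro: continuous_on_norm)
  have op: "open {t \<in> {0<..}. a < norm (R t)}" for a
  proof (cases "a < 0")
    case True
    then have "{t \<in> {0<..}. a < norm (R t)} = {0<..}"
      using less_le_trans[OF _ norm_ge_zero] by auto
    then show ?thesis by simp
  next
    case False
    have "a < norm (R t) \<longleftrightarrow> (\<exists>x. a * norm x < norm (blinfun_apply (R t) x))" for t
    proof
      assume "a < norm (R t)"
      then show "\<exists>x. a * norm x < norm (blinfun_apply (R t) x)"
        using norm_blinfun_bound[of a "R t"] False by (meson not_less)
    next
      assume "\<exists>x. a * norm x < norm (blinfun_apply (R t) x)"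
      then obtain x where x: "a * norm x < norm (blinfun_apply (R t) x)" by blast
      also have "\<dots> \<le> norm (R t) * norm x" by (rule norm_blinfun)
      finally show "a < norm (R t)" by (rule mult_right_less_imp_less) simp
    qed
    then have eq: "{t \<in> {0<..}. a < norm (R t)}
        = (\<Union>x. (\<lambda>t. norm (blinfun_apply (R t) x)) -` {a * norm x<..} \<inter> {0<..})"
      by auto
    have "open ((\<lambda>t. norm (blinfun_apply (R t) x)) -` {a * norm x<..} \<inter> {0<..})" for x
      using cont[of x] by (subst (asm) continuous_on_open_vimage) auto
    then show ?thesis unfolding eq by (intro open_UN ballI)
  qed
  have "(\<lambda>t. norm (R t)) \<in> borel_measurable (lebesgue_on {0<..})"
    unfolding borel_measurable_iff_greater
  proof
    fix a
    show "{t \<in> space (lebesgue_on {0<..}). a < norm (R t)} \<in> sets (lebesgue_on {0<..})"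
      using op[of a] by (auto simp: sets_restrict_space_iff)
  qed
  then have "(\<lambda>t. if t \<in> {0<..} then norm (R t) else 0) \<in> borel_measurable lebesgue"
    by (rule borel_measurable_if_I) auto
  then have "(\<lambda>t. if t \<in> {0<..} then norm (R t) else 0) \<in> borel_measurable (lebesgue_on S)"
    by (rule measurable_restrict_space1)
  moreover have "AE t in lebesgue_on S. (if t \<in> {0<..} then norm (R t) else 0) = norm (R t)"
  proof -
    have "AE t in lebesgue. t \<noteq> (0::real)"
      by (intro AE_completion AE_lborel_singleton)
    then show ?thesis
      using S by (subst AE_restrict_space_iff) (auto elim!: eventually_mono simp: less_le)
  qed
  ultimately show ?thesis
    by (rule complete_measure.borel_measurable_AE_eq[OF complete_measure_lebesgue_on[OF S(1)]])
qed

text \<open>For simple \<open>h\<close> the function is patched together from finitely many orbits \<open>r \<mapsto> R r e\<close>, which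
  are continuous, so their values at rational times are dense in their ranges; the general case is
  a limit because each \<open>R r\<close> is continuous.\<close>

lemma strongly_measurable_strongly_continuous_apply:
  fixes R :: "real \<Rightarrow> 'e::complex_banach \<Rightarrow>\<^sub>L 'x::complex_banach"
  assumes R: "strongly_continuous_family R" and h: "strongly_measurable (lebesgue_on {0<..}) h"
  shows "strongly_measurable (lebesgue_on {0<..}) (\<lambda>r. blinfun_apply (R r) (h r))"
proof -
  interpret complete_measure "lebesgue_on {0::real<..}"
    by (intro complete_measure_lebesgue_on) auto
  have cont: "continuous_on {0<..} (\<lambda>t. blinfun_apply (R t) x)" for x
    using R by (auto simp: strongly_continuous_family_def)
  have simple: "strongly_measurable (lebesgue_on {0<..}) (\<lambda>r. blinfun_apply (R r) (s r))"
    if s: "simple_function (lebesgue_on {0<..}) s" for s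
  proof (rule strongly_measurableI_separable)
    have fin: "finite (s ` {0<..})" using s by (simp add: simple_function_def)
    show "(\<lambda>r. dist (blinfun_apply (R r) (s r)) c) \<in> borel_measurable (lebesgue_on {0<..})" for c
    proof (rule measurable_compose_countable'[of "s ` {0<..}" "\<lambda>e r. dist (blinfun_apply (R r) e) c"])
      show "(\<lambda>r. dist (blinfun_apply (R r) e) c) \<in> borel_measurable (lebesgue_on {0<..})" for e
        by (intro continuous_imp_measurable_on_sets_lebesgue continuous_on_dist cont
            continuous_on_const) auto
      show "s \<in> measurable (lebesgue_on {0<..}) (count_space (s ` {0<..}))"
        using measurable_simple_function[OF s] by (auto simp: measurable_count_space_eq2 fin measurable_def)
      show "countable (s ` {0<..})" using fin by (rule countable_finite)
    qed
    let ?D = "\<Union>e\<in>s ` {0<..}. (\<lambda>r. blinfun_apply (R r) e) ` (\<rat> \<inter> {0<..})"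
    show "countable ?D"
      by (intro countable_UN[OF countable_finite[OF fin]] countable_image countable_Int1[OF countable_rat])
    have "blinfun_apply (R r) (s r) \<in> closure ?D" if r: "0 < r" for r
    proof (subst closure_approachable, intro allI impI)
      fix e :: real assume "0 < e"
      then obtain d where d: "0 < d"
        "\<And>u. 0 < u \<Longrightarrow> dist u r < d \<Longrightarrow> dist (blinfun_apply (R u) (s r)) (blinfun_apply (R r) (s r)) < e"
        using cont[of "s r"] r unfolding continuous_on_iff by force
      obtain u where u: "u \<in> \<rat>" "r < u" "u < r + d"
        using Rats_dense_in_real[of r "r + d"] d(1) by auto
      have "blinfun_apply (R u) (s r) \<in> ?D"
        using r u by (intro UN_I[of "s r"] imageI) auto
      moreover have "dist (blinfun_apply (R u) (s r)) (blinfun_apply (R r) (s r)) < e"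
        using r u by (intro d(2)) (auto simp: dist_real_def)
      ultimately show "\<exists>y\<in>?D. dist y (blinfun_apply (R r) (s r)) < e" ..
    qed
    then show "AE r in lebesgue_on {0<..}. blinfun_apply (R r) (s r) \<in> closure ?D"
      by (intro AE_I2) auto
  qed
  from h obtain s where
    s: "\<And>i::nat. simple_function (lebesgue_on {0<..}) (s i)"
      "AE r in lebesgue_on {0<..}. (\<lambda>i. s i r) \<longlonglongrightarrow> h r"
    unfolding strongly_measurable_def by blast
  show ?thesis
  proof (rule strongly_measurable_AE_LIMSEQ[OF simple[OF s(1)]])
    show "AE r in lebesgue_on {0<..}. (\<lambda>i. blinfun_apply (R r) (s i r)) \<longlonglongrightarrow> blinfun_apply (R r) (h r)"
      using s(2) by eventually_elim (intro tendsto_intros)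
  qed
qed

section \<open>Convolution with a summable operator kernel\<close>

lemma nn_integral_halfline_le_unit_intervals:
  fixes F :: "real \<Rightarrow> ennreal"
  assumes F: "F \<in> borel_measurable (lebesgue_on {0<..})"
  shows "(\<integral>\<^sup>+r. F r \<partial>lebesgue_on {0<..}) \<le> (\<Sum>j::nat. \<integral>\<^sup>+r. F r \<partial>lebesgue_on {real j..real j + 1})"
proof -
  let ?F = "\<lambda>r. F r * indicator {0<..} r"
  have meas: "?F \<in> borel_measurable lebesgue"
    using F by (subst (asm) borel_measurable_restrict_space_iff_ennreal) auto
  have cover: "?F r \<le> (\<Sum>j::nat. ?F r * indicator {real j..real j + 1} r)" for r
  proof (cases "0 < r")
    case True
    define j where "j = nat \<lfloor>r\<rfloor>"
    have "r \<in> {real j..real j + 1}"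
      using True floor_correct[of r] by (simp add: j_def less_imp_le)
    then have "?F r = (\<Sum>i\<in>{j}. ?F r * indicator {real i..real i + 1} r)" by simp
    also have "\<dots> \<le> (\<Sum>i. ?F r * indicator {real i..real i + 1} r)"
      by (rule sum_le_suminf) auto
    finally show ?thesis .
  qed simp
  have "(\<integral>\<^sup>+r. F r \<partial>lebesgue_on {0<..}) = (\<integral>\<^sup>+r. ?F r \<partial>lebesgue)"
    by (simp add: nn_integral_restrict_space)
  also have "\<dots> \<le> (\<integral>\<^sup>+r. (\<Sum>j::nat. ?F r * indicator {real j..real j + 1} r) \<partial>lebesgue)"
    by (intro nn_integral_mono cover)
  also have "\<dots> = (\<Sum>j::nat. \<integral>\<^sup>+r. ?F r * indicator {real j..real j + 1} r \<partial>lebesgue)"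
    by (intro nn_integral_suminf borel_measurable_times_ennreal[OF meas] borel_measurable_indicator) auto
  also have "\<dots> \<le> (\<Sum>j::nat. \<integral>\<^sup>+r. F r \<partial>lebesgue_on {real j..real j + 1})"
    by (intro suminf_le nn_integral_mono)
      (auto simp: nn_integral_restrict_space indicator_def intro!: nn_integral_mono)
  finally show ?thesis .
qed

locale summable_kernel =
  fixes R :: "real \<Rightarrow> 'e::complex_banach \<Rightarrow>\<^sub>L 'x::complex_banach"
    and q :: real and q' :: ennreal
  assumes exponent: "1 \<le> q" "1 / q' + 1 / ennreal q = 1"
    and strongly_continuous: "strongly_continuous_family R"
    and summable_norms:
      "(\<Sum>j::nat. Lp_norm q' (lebesgue_on {real j..real j + 1}) (\<lambda>t. norm (R t))) < \<infinity>"
begin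

definition kernel_norm :: "nat \<Rightarrow> real"
  where "kernel_norm j = enn2real (Lp_norm q' (lebesgue_on {real j..real j + 1}) (\<lambda>t. norm (R t)))"

lemma kernel_norm_nonneg: "0 \<le> kernel_norm j"
  by (simp add: kernel_norm_def)

lemma ennreal_kernel_norm:
  "ennreal (kernel_norm j) = Lp_norm q' (lebesgue_on {real j..real j + 1}) (\<lambda>t. norm (R t))"
proof -
  let ?L = "\<lambda>j::nat. Lp_norm q' (lebesgue_on {real j..real j + 1}) (\<lambda>t. norm (R t))"
  have "(\<Sum>i\<in>{j}. ?L i) \<le> (\<Sum>i. ?L i)" by (rule sum_le_suminf) auto
  with summable_norms have "?L j < \<infinity>" by (simp add: less_top[symmetric] top_unique) (metis top_unique)
  then show ?thesis by (simp add: kernel_norm_def)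
qed

lemma summable_kernel_norm: "summable kernel_norm"
proof (rule summable_suminf_not_top)
  show "(\<Sum>j. ennreal (kernel_norm j)) \<noteq> top"
    using summable_norms by (simp add: ennreal_kernel_norm less_top)
qed (rule kernel_norm_nonneg)

abbreviation kernel_mass :: real
  where "kernel_mass \<equiv> (\<Sum>j. kernel_norm j)"

lemma strongly_measurable_convolution:
  assumes h: "strongly_measurable lebesgue h"
  shows "strongly_measurable (lebesgue_on {0<..}) (\<lambda>r. blinfun_apply (R r) (h (t - r)))"
  by (intro strongly_measurable_strongly_continuous_apply strongly_continuous
      completion.strongly_measurable_restrict_space
      strongly_measurable_distr[OF measurable_lebesgue_reflect distr_lebesgue_reflect h]) auto

text \<open>The central estimate: Hoelder's inequality on each interval \<open>[j, j + 1]\<close>, followed by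
  summation over \<open>j\<close>.\<close>

lemma nn_integral_convolution_le:
  assumes h: "strongly_measurable lebesgue h"
    and a: "\<And>j::nat. 0 \<le> a j" "summable (\<lambda>j. kernel_norm j * a j)"
      "\<And>j. Lp_norm (ennreal q) (lebesgue_on {0..1}) (\<lambda>s. h (t - real j - 1 + s)) \<le> ennreal (a j)"
  shows "(\<integral>\<^sup>+r. ennreal (norm (blinfun_apply (R r) (h (t - r)))) \<partial>lebesgue_on {0<..})
    \<le> ennreal (\<Sum>j. kernel_norm j * a j)"
proof -
  interpret complete_measure "lebesgue_on {0::real<..}"
    by (intro complete_measure_lebesgue_on) auto
  have "(\<integral>\<^sup>+r. ennreal (norm (blinfun_apply (R r) (h (t - r)))) \<partial>lebesgue_on {0<..})
      \<le> (\<Sum>j::nat. \<integral>\<^sup>+r. ennreal (norm (blinfun_apply (R r) (h (t - r)))) \<partial>lebesgue_on {real j..real j + 1})"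
    by (intro nn_integral_halfline_le_unit_intervals measurable_compose[OF _ measurable_ennreal]
        norm_strongly_measurable strongly_measurable_convolution h)
  also have "\<dots> \<le> (\<Sum>j. ennreal (kernel_norm j * a j))"
  proof (rule suminf_le)
    fix j :: nat
    let ?J = "{real j..real j + 1}"
    have "(\<integral>\<^sup>+r. ennreal (norm (blinfun_apply (R r) (h (t - r)))) \<partial>lebesgue_on ?J)
        \<le> (\<integral>\<^sup>+r. ennreal (norm (norm (R r)) * norm (h (t - r))) \<partial>lebesgue_on ?J)"
      by (intro nn_integral_mono ennreal_leI) (simp add: norm_blinfun)
    also have "\<dots> \<le> Lp_norm q' (lebesgue_on ?J) (\<lambda>r. norm (R r))
        * Lp_norm (ennreal q) (lebesgue_on ?J) (\<lambda>r. h (t - r))"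
    proof (rule Holder_inequality[OF exponent])
      show "(\<lambda>r. norm (norm (R r))) \<in> borel_measurable (lebesgue_on ?J)"
        using strongly_continuous_norm_measurable[OF strongly_continuous, of ?J] by auto
      show "(\<lambda>r. norm (h (t - r))) \<in> borel_measurable (lebesgue_on ?J)"
        by (intro measurable_restrict_space1 completion.norm_strongly_measurable
            strongly_measurable_distr[OF measurable_lebesgue_reflect distr_lebesgue_reflect h])
    qed
    also have "\<dots> \<le> ennreal (kernel_norm j) * ennreal (a j)"
      using a(3)[of j] exponent(1) h
      by (simp add: ennreal_kernel_norm Lp_norm_reflect mult_left_mono)
    also have "\<dots> = ennreal (kernel_norm j * a j)"
      using a(1) kernel_norm_nonneg by (simp add: ennreal_mult)
    finally show "(\<integral>\<^sup>+r. ennreal (norm (blinfun_apply (R r) (h (t - r)))) \<partial>lebesgue_on ?J)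
        \<le> ennreal (kernel_norm j * a j)" .
  qed auto
  also have "\<dots> = ennreal (\<Sum>j. kernel_norm j * a j)"
    using a kernel_norm_nonneg by (intro suminf_ennreal2) auto
  finally show ?thesis .
qed

end

section \<open>The convolution of a Stepanov bounded function\<close>

lemma bounded_linear_scaleC: "bounded_linear (\<lambda>x::'a::complex_banach. c *\<^sub>C x)"
proof (rule bounded_linear_intro)
  fix x y :: 'a and r :: real
  show "c *\<^sub>C (x + y) = c *\<^sub>C x + c *\<^sub>C y" by (rule scaleC_add_right)
  show "c *\<^sub>C (r *\<^sub>R x) = r *\<^sub>R (c *\<^sub>C x)"
    by (simp add: scaleC_scaleC mult.commute flip: scaleC_of_real)
  show "norm (c *\<^sub>C x) \<le> norm x * cmod c" by (simp add: norm_scaleC)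
qed

lemma Lp_norm_scaleC_le:
  fixes f :: "'a \<Rightarrow> 'b::complex_banach"
  assumes q: "0 < q" and A: "0 \<le> A" and f: "(\<lambda>x. norm (f x)) \<in> borel_measurable M"
    "Lp_norm (ennreal q) M f \<le> ennreal A"
  shows "Lp_norm (ennreal q) M (\<lambda>x. c *\<^sub>C f x) \<le> ennreal (cmod c * A)"
proof -
  note [measurable] = f(1)
  have "(\<integral>\<^sup>+x. ennreal (norm (c *\<^sub>C f x) powr q) \<partial>M)
      = ennreal (cmod c powr q) * (\<integral>\<^sup>+x. ennreal (norm (f x) powr q) \<partial>M)"
    by (simp add: norm_scaleC powr_mult ennreal_mult nn_integral_cmult)
  also have "\<dots> \<le> ennreal (cmod c powr q) * ennreal (A powr q)"
    using f(2) by (intro mult_left_mono) (simp_all add: Lp_norm_le_iff[OF q A])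
  also have "\<dots> = ennreal ((cmod c * A) powr q)"
    using A by (simp add: powr_mult flip: ennreal_mult)
  finally show ?thesis using A by (subst Lp_norm_le_iff[OF q]) auto
qed

lemma strongly_measurable_hat:
  assumes "strongly_measurable lebesgue g"
  shows "strongly_measurable (lebesgue_on {0..1}) (hat g t)"
  unfolding hat_def
  by (intro completion.strongly_measurable_restrict_space
      strongly_measurable_distr[OF measurable_lebesgue_translate distr_lebesgue_translate assms]) auto

text \<open>The assumptions on \<open>g\<close> are what the Bloch case and the anti-periodic case have in common.\<close>

locale stepanov_convolution = summable_kernel R q q'
  for R :: "real \<Rightarrow> 'e::complex_banach \<Rightarrow>\<^sub>L 'x::complex_banach" and q :: real and q' :: ennreal +
  fixes g :: "real \<Rightarrow> 'e"
  assumes Stepanov: "Stepanov_bounded q g"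
    and hat_bounded_continuous: "bounded_continuous_in (unit_Lp q) (unit_Lp_norm q) (hat g)"
begin

definition G :: "real \<Rightarrow> 'x"
  where "G t = Bochner_integral (lebesgue_on {..<t}) (\<lambda>s. blinfun_apply (R (t - s)) (g s))"

lemma g_strongly_measurable: "strongly_measurable lebesgue g"
  using Stepanov by (intro strongly_measurable_lebesgueI)
    (auto simp: Stepanov_bounded_def Lp_loc_def Lp_space_def)

lemma hat_bound:
  "\<exists>B\<ge>0. \<forall>t. Lp_norm (ennreal q) (lebesgue_on {0..1}) (hat g t) \<le> ennreal B"
proof -
  from hat_bounded_continuous obtain B where
    B: "\<And>t. unit_Lp_norm q (hat g t) \<le> B" and "range (hat g) \<subseteq> unit_Lp q"
    by (auto simp: bounded_continuous_in_def)
  then have fin: "Lp_norm (ennreal q) (lebesgue_on {0..1}) (hat g t) < \<infinity>" for t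
    by (auto simp: Lp_space_def)
  show ?thesis
  proof (intro exI[of _ B] conjI allI)
    show "0 \<le> B" using B[of 0] enn2real_nonneg order_trans by blast
    show "Lp_norm (ennreal q) (lebesgue_on {0..1}) (hat g t) \<le> ennreal B" for t
      using fin[of t] ennreal_leI[OF B[of t]] by simp
  qed
qed

text \<open>The bound serves twice: it is the majorant in the proof of continuity, and it shows that the
  norm is finite, without which \<open>unit_Lp_norm\<close>, sending \<open>\<infinity>\<close> to 0, would carry no information.\<close>

lemma hat_diff_bound:
  "\<exists>D\<ge>0. \<forall>u v. Lp_norm (ennreal q) (lebesgue_on {0..1}) (hat g u - c *\<^sub>C hat g v) \<le> ennreal D"
proof -
  interpret I: complete_measure "lebesgue_on {0..1::real}"
    by (intro complete_measure_lebesgue_on) auto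
  obtain B where B: "0 \<le> B" "\<And>t. Lp_norm (ennreal q) (lebesgue_on {0..1}) (hat g t) \<le> ennreal B"
    using hat_bound by blast
  define A where "A = max B (cmod c * B)"
  have A: "0 \<le> A" "B \<le> A" "cmod c * B \<le> A" using B(1) by (auto simp: A_def)
  note sm = strongly_measurable_hat[OF g_strongly_measurable]
  have "Lp_norm (ennreal q) (lebesgue_on {0..1}) (\<lambda>s. hat g u s - c *\<^sub>C hat g v s) \<le> ennreal (4 * A)" for u v
  proof (rule I.Lp_norm_diff_le[OF exponent(1) A(1) sm])
    show "Lp_norm (ennreal q) (lebesgue_on {0..1}) (hat g u) \<le> ennreal A"
      by (rule order_trans[OF B(2) ennreal_leI[OF A(2)]])
    show "strongly_measurable (lebesgue_on {0..1}) (\<lambda>s. c *\<^sub>C hat g v s)"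
      by (rule strongly_measurable_bounded_linear[OF bounded_linear_scaleC sm])
    have "Lp_norm (ennreal q) (lebesgue_on {0..1}) (\<lambda>s. c *\<^sub>C hat g v s) \<le> ennreal (cmod c * B)"
      using exponent(1) B by (intro Lp_norm_scaleC_le I.norm_strongly_measurable sm) auto
    then show "Lp_norm (ennreal q) (lebesgue_on {0..1}) (\<lambda>s. c *\<^sub>C hat g v s) \<le> ennreal A"
      by (rule order_trans[OF _ ennreal_leI[OF A(3)]])
  qed
  then show ?thesis
    using A(1) by (intro exI[of _ "4 * A"]) (auto simp: fun_diff_def scaleC_fun_def)
qed

lemma ennreal_hat_diff:
  "ennreal (unit_Lp_norm q (hat g u - c *\<^sub>C hat g v))
    = Lp_norm (ennreal q) (lebesgue_on {0..1}) (hat g u - c *\<^sub>C hat g v)"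
proof -
  obtain D where D: "0 \<le> D"
    "\<And>u v. Lp_norm (ennreal q) (lebesgue_on {0..1}) (hat g u - c *\<^sub>C hat g v) \<le> ennreal D"
    using hat_diff_bound by blast
  from D(2)[of u v] have "Lp_norm (ennreal q) (lebesgue_on {0..1}) (hat g u - c *\<^sub>C hat g v) < \<infinity>"
    by (simp add: le_less_trans[OF _ ennreal_less_top])
  then show ?thesis by simp
qed

lemma
  shows integrable_G: "Bochner_integrable (lebesgue_on {..<t}) (\<lambda>s. blinfun_apply (R (t - s)) (g s))"
    and has_integral_G: "has_Bochner_integral (lebesgue_on {0<..}) (\<lambda>r. blinfun_apply (R r) (g (t - r))) (G t)"
proof -
  interpret P: complete_measure "lebesgue_on {0::real<..}"
    by (intro complete_measure_lebesgue_on) auto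
  interpret L: complete_measure "lebesgue_on {..<t}"
    by (intro complete_measure_lebesgue_on) auto
  obtain B where B: "0 \<le> B" "\<And>t. Lp_norm (ennreal q) (lebesgue_on {0..1}) (hat g t) \<le> ennreal B"
    using hat_bound by blast
  have "(\<integral>\<^sup>+r. ennreal (norm (blinfun_apply (R r) (g (t - r)))) \<partial>lebesgue_on {0<..})
      \<le> ennreal (\<Sum>j. kernel_norm j * B)"
    using B by (intro nn_integral_convolution_le g_strongly_measurable
        summable_mult2 summable_kernel_norm) (auto simp: hat_def[abs_def])
  then have "(\<integral>\<^sup>+r. ennreal (norm (blinfun_apply (R r) (g (t - r)))) \<partial>lebesgue_on {0<..}) < \<infinity>"
    by (simp add: le_less_trans[OF _ ennreal_less_top])
  then obtain y where
    y: "has_Bochner_integral (lebesgue_on {0<..}) (\<lambda>r. blinfun_apply (R r) (g (t - r))) y"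
    by (rule P.has_Bochner_integral_exists[OF strongly_measurable_convolution[OF g_strongly_measurable]])
  have y': "has_Bochner_integral (lebesgue_on {..<t}) (\<lambda>s. blinfun_apply (R (t - s)) (g s)) y"
    using P.has_Bochner_integral_distr[OF lebesgue_on_reflect[of t] y] by simp
  then show "Bochner_integrable (lebesgue_on {..<t}) (\<lambda>s. blinfun_apply (R (t - s)) (g s))"
    unfolding Bochner_integrable_def by blast
  show "has_Bochner_integral (lebesgue_on {0<..}) (\<lambda>r. blinfun_apply (R r) (g (t - r))) (G t)"
    using y unfolding G_def L.Bochner_integral_eq[OF y'] .
qed

text \<open>The function \<open>h s = g (s + x - y) - c g s\<close> satisfies
  \<open>R r (h (y - r)) = R r (g (x - r)) - c R r (g (y - r))\<close> by complex linearity, so its convolution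
  at \<open>y\<close> is \<open>G x - c G y\<close>.\<close>

lemma norm_G_diff_le:
  assumes a: "\<And>j::nat. unit_Lp_norm q (hat g (x - real j - 1) - c *\<^sub>C hat g (y - real j - 1)) \<le> a j"
    and sum: "summable (\<lambda>j. kernel_norm j * a j)"
  shows "norm (G x - c *\<^sub>C G y) \<le> (\<Sum>j. kernel_norm j * a j)"
proof -
  interpret P: complete_measure "lebesgue_on {0::real<..}"
    by (intro complete_measure_lebesgue_on) auto
  define h where "h s = g ((x - y) + s) - c *\<^sub>C g s" for s
  have h: "strongly_measurable lebesgue h"
    unfolding h_def
    by (intro strongly_measurable_diff strongly_measurable_bounded_linear[OF bounded_linear_scaleC]
        strongly_measurable_distr[OF measurable_lebesgue_translate distr_lebesgue_translate]
        g_strongly_measurable)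
  have a0: "0 \<le> a j" for j by (rule order_trans[OF enn2real_nonneg a])
  have "ennreal (dist (G x) (c *\<^sub>C G y)) \<le> (\<integral>\<^sup>+r. ennreal (dist (blinfun_apply (R r) (g (x - r)))
      (c *\<^sub>C blinfun_apply (R r) (g (y - r)))) \<partial>lebesgue_on {0<..})"
    by (intro P.has_Bochner_integral_dist_le has_integral_G
        P.has_Bochner_integral_bounded_linear[OF bounded_linear_scaleC])
  also have "\<dots> = (\<integral>\<^sup>+r. ennreal (norm (blinfun_apply (R r) (h (y - r)))) \<partial>lebesgue_on {0<..})"
  proof (intro nn_integral_cong)
    fix r assume "r \<in> space (lebesgue_on {0::real<..})"
    then have "R r \<in> clinear_ops"
      using strongly_continuous by (simp add: strongly_continuous_family_def)
    then show "ennreal (dist (blinfun_apply (R r) (g (x - r))) (c *\<^sub>C blinfun_apply (R r) (g (y - r))))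
        = ennreal (norm (blinfun_apply (R r) (h (y - r))))"
      by (simp add: clinear_ops_def h_def dist_norm blinfun.diff_right)
  qed
  also have "\<dots> \<le> ennreal (\<Sum>j. kernel_norm j * a j)"
  proof (rule nn_integral_convolution_le[OF h a0 sum])
    fix j :: nat
    have "(\<lambda>s. h (y - real j - 1 + s)) = hat g (x - real j - 1) - c *\<^sub>C hat g (y - real j - 1)"
      by (simp add: h_def hat_def fun_eq_iff scaleC_fun_def algebra_simps)
    then show "Lp_norm (ennreal q) (lebesgue_on {0..1}) (\<lambda>s. h (y - real j - 1 + s)) \<le> ennreal (a j)"
      using ennreal_leI[OF a[of j]] by (simp add: ennreal_hat_diff)
  qed
  finally show ?thesis
    using sum a0 kernel_norm_nonneg by (simp add: dist_norm ennreal_le_iff suminf_nonneg)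
qed

lemma norm_G_diff_le_uniform:
  assumes "\<And>x. unit_Lp_norm q (hat g (x + p) - c *\<^sub>C hat g x) \<le> \<epsilon>"
  shows "norm (G (x + p) - c *\<^sub>C G x) \<le> kernel_mass * \<epsilon>"
proof -
  have "norm (G (x + p) - c *\<^sub>C G x) \<le> (\<Sum>j. kernel_norm j * \<epsilon>)"
  proof (rule norm_G_diff_le)
    fix j :: nat
    show "unit_Lp_norm q (hat g (x + p - real j - 1) - c *\<^sub>C hat g (x - real j - 1)) \<le> \<epsilon>"
      using assms[of "x - real j - 1"] by (simp add: algebra_simps)
  qed (intro summable_mult2 summable_kernel_norm)
  then show ?thesis by (simp add: suminf_mult2 summable_kernel_norm)
qed

text \<open>Boundedness is the case \<open>c = 0\<close> of the difference estimate. For continuity at \<open>t\<close> the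
  bounding series tends to 0 termwise and is dominated by \<open>kernel_norm j * D\<close>, so Tannery's
  theorem applies.\<close>

lemma bounded_continuous_G: "bounded_continuous_in UNIV norm G"
  unfolding bounded_continuous_in_norm
proof
  show "bounded (range G)"
  proof -
    obtain D where D: "0 \<le> D"
      "\<And>u v. Lp_norm (ennreal q) (lebesgue_on {0..1}) (hat g u - 0 *\<^sub>C hat g v) \<le> ennreal D"
      using hat_diff_bound by blast
    have "norm (G x) \<le> kernel_mass * D" for x
    proof -
      have "norm (G (x + 0) - 0 *\<^sub>C G x) \<le> kernel_mass * D"
        using enn2real_mono[OF D(2)] D(1) by (intro norm_G_diff_le_uniform) simp
      moreover have "0 *\<^sub>C G x = 0" using scaleC_of_real[of 0 "G x"] by simp
      ultimately show ?thesis by simp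
    qed
    then show ?thesis unfolding bounded_iff by blast
  qed
  obtain D where D: "0 \<le> D"
    "\<And>u v. Lp_norm (ennreal q) (lebesgue_on {0..1}) (hat g u - 1 *\<^sub>C hat g v) \<le> ennreal D"
    using hat_diff_bound by blast
  have "isCont G t" for t
  proof -
    let ?a = "\<lambda>j u. unit_Lp_norm q (hat g (u - real j - 1) - hat g (t - real j - 1))"
    have aD: "?a j u \<le> D" for j u
      using enn2real_mono[OF D(2)] D(1) by (simp add: scaleC_one)
    have sum: "summable (\<lambda>j. kernel_norm j * D)"
      by (intro summable_mult2 summable_kernel_norm)
    have le: "norm (kernel_norm j * ?a j u) \<le> kernel_norm j * D" for j u
      using aD kernel_norm_nonneg by (simp add: mult_left_mono)
    have term_lim: "((\<lambda>u. kernel_norm j * ?a j u) \<longlongrightarrow> 0) (at t)" for j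
    proof (intro tendsto_mult_right_zero tendstoI)
      fix e :: real assume "0 < e"
      then obtain d where d: "0 < d" "\<And>v. \<bar>v - (t - real j - 1)\<bar> < d
          \<Longrightarrow> unit_Lp_norm q (hat g v - hat g (t - real j - 1)) < e"
        using hat_bounded_continuous unfolding bounded_continuous_in_def by blast
      have "dist (?a j u) 0 < e" if "dist u t < d" for u
        using d(2)[of "u - real j - 1"] that by (simp add: dist_real_def)
      with d(1) show "\<forall>\<^sub>F u in at t. dist (?a j u) 0 < e"
        unfolding eventually_at by blast
    qed
    have "((\<lambda>u. \<Sum>j. kernel_norm j * ?a j u) \<longlongrightarrow> (\<Sum>j. 0)) (at t)"
      using tannerys_theorem[OF term_lim always_eventually sum] le by simp
    then have lim: "((\<lambda>u. \<Sum>j. kernel_norm j * ?a j u) \<longlongrightarrow> 0) (at t)" by simp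
    have "norm (G u - G t) \<le> (\<Sum>j. kernel_norm j * ?a j u)" for u
      using norm_G_diff_le[of u 1 t "\<lambda>j. ?a j u"] summable_comparison_test'[OF sum le]
      by (simp add: scaleC_one)
    then have "((\<lambda>u. G u - G t) \<longlongrightarrow> 0) (at t)"
      by (intro Lim_null_comparison[OF always_eventually lim]) simp
    then show ?thesis by (simp add: isCont_def LIM_zero_iff)
  qed
  then show "continuous_on UNIV G" by (simp add: continuous_at_imp_continuous_on)
qed

lemma semi_periodic_transfer:
  assumes phase: "\<And>\<epsilon>::real. 0 < \<epsilon> \<Longrightarrow> \<exists>p>0. \<forall>m::int. \<forall>x.
      unit_Lp_norm q (hat g (x + of_int m * p) - c m p *\<^sub>C hat g x) \<le> \<epsilon>"
    and "0 < \<epsilon>"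
  shows "\<exists>p>0. \<forall>m::int. \<forall>x. norm (G (x + of_int m * p) - c m p *\<^sub>C G x) \<le> \<epsilon>"
proof -
  have mass: "0 \<le> kernel_mass" by (intro suminf_nonneg summable_kernel_norm kernel_norm_nonneg)
  \<comment> \<open>The summand 1 in the denominator keeps the quotient meaningful when the kernel vanishes.\<close>
  define \<delta> where "\<delta> = \<epsilon> / (kernel_mass + 1)"
  have \<delta>: "0 < \<delta>" "kernel_mass * \<delta> \<le> \<epsilon>"
    using mass \<open>0 < \<epsilon>\<close> by (auto simp: \<delta>_def field_simps)
  obtain p where p: "0 < p" "\<And>m x. unit_Lp_norm q (hat g (x + of_int m * p) - c m p *\<^sub>C hat g x) \<le> \<delta>"
    using phase[OF \<delta>(1)] by blast
  have "norm (G (x + of_int m * p) - c m p *\<^sub>C G x) \<le> \<epsilon>" for m x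
    using norm_G_diff_le_uniform[OF p(2)[of _ m]] \<delta>(2) by (rule order_trans)
  with p(1) show ?thesis by blast
qed

end

section \<open>Invariance of semi-Bloch and semi-anti-periodicity\<close>

theorem proposition4p1:
  fixes R :: "real \<Rightarrow> 'e::complex_banach \<Rightarrow>\<^sub>L 'x::complex_banach"
    and g :: "real \<Rightarrow> 'e"
    and k q :: real
    and q' :: ennreal
  assumes "1 \<le> q"
    and "1 / q' + 1 / ennreal q = 1"
    and "strongly_continuous_family R"
    and "(\<Sum>j::nat. Lp_norm q' (lebesgue_on {real j..real j + 1}) (\<lambda>t. norm (R t))) < \<infinity>"
  shows "let G = (\<lambda>t. Bochner_integral (lebesgue_on {..<t}) (\<lambda>s. blinfun_apply (R (t - s)) (g s)));
             well_defined = (\<forall>t. Bochner_integrable (lebesgue_on {..<t}) (\<lambda>s. blinfun_apply (R (t - s)) (g s)))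
         in (Stepanov_semi_Bloch_periodic q k g \<longrightarrow> well_defined \<and> semi_Bloch_periodic k G) \<and>
            (Stepanov_semi_anti_periodic q g \<longrightarrow> well_defined \<and> semi_anti_periodic G)"
proof -
  interpret summable_kernel R q q' using assms by unfold_locales
  define G where "G = (\<lambda>t. Bochner_integral (lebesgue_on {..<t}) (\<lambda>s. blinfun_apply (R (t - s)) (g s)))"
  have 1: "(\<forall>t. Bochner_integrable (lebesgue_on {..<t}) (\<lambda>s. blinfun_apply (R (t - s)) (g s)))
      \<and> semi_Bloch_periodic k G" if g: "Stepanov_semi_Bloch_periodic q k g"
  proof -
    interpret S: stepanov_convolution R q q' g
      using g by unfold_locales (auto simp: Stepanov_semi_Bloch_periodic_def semi_Bloch_periodic_in_def)
    have "S.G = G" by (simp add: fun_eq_iff S.G_def G_def)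
    then show ?thesis
      using g S.integrable_G S.bounded_continuous_G
        S.semi_periodic_transfer[of "\<lambda>m p. exp (\<i> * of_real (k * of_int m * p))"]
      by (simp add: Stepanov_semi_Bloch_periodic_def semi_Bloch_periodic_def semi_Bloch_periodic_in_def)
  qed
  have 2: "(\<forall>t. Bochner_integrable (lebesgue_on {..<t}) (\<lambda>s. blinfun_apply (R (t - s)) (g s)))
      \<and> semi_anti_periodic G" if g: "Stepanov_semi_anti_periodic q g"
  proof -
    interpret S: stepanov_convolution R q q' g
      using g by unfold_locales (auto simp: Stepanov_semi_anti_periodic_def semi_anti_periodic_in_def)
    have "S.G = G" by (simp add: fun_eq_iff S.G_def G_def)
    then show ?thesis
      using g S.integrable_G S.bounded_continuous_G S.semi_periodic_transfer[of "\<lambda>m p. (- 1) powi m"]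
      by (simp add: Stepanov_semi_anti_periodic_def semi_anti_periodic_def semi_anti_periodic_in_def)
  qed
  from 1 2 show ?thesis unfolding Let_def G_def by blast
qed

end
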